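(* Let $E\subset\mathbb{R}_{>1}$ be a finite alphabet, let $\mathbf{B}\in E^{\mathbb{N}}$ be a Cantor real base, and let $b\ge2$ be an integer. Let $A$ be the finite alphabet of digits that can occur in the sequences $d^*_{\sigma^n(\mathbf{B})}(1)$, $n\ge0$, and assume that for every $a\in A$ we are given a first-order formula $\varphi_a(j,n)$ of the structure $\langle\mathbb{N},+,V_b\rangle$ that is true if and only if the digit at position $j$ of $d^*_{\sigma^n(\mathbf{B})}(1)$ equals $a$. Then it is decidable whether a given $b$-automatic sequence over $\mathbb{N}$ is $\mathbf{B}$-admissible.
   Context: A Cantor real base is a sequence $\mathbf{B}=(\beta_n)_{n\in\mathbb{N}}$ of reals $>1$ with $\prod_n\beta_n=+\infty$; $\sigma$ denotes the shift, $\sigma((x_n)_{n})=(x_{n+1})_n$. With $\mathsf{T}_\beta(r)=\beta r-\lfloor\beta r\rfloor$ on $[0,1]$, the greedy $\mathbf{B}$-expansion of $r\in[0,1]$ is $d_{\mathbf{B}}(r)=(a_n)_n$ with $a_n=\lfloor\beta_n\mathsf{T}_{\beta_{n-1}}\cdots\mathsf{T}_{\beta_0}(r)\rfloor$; the quasi-greedy expansion is $d^*_{\mathbf{B}}(r)=\lim_{z\to r^-}d_{\mathbf{B}}(z)$ (limit in the product topology). Positions in sequences are indexed from $0$. An infinite sequence $\mathbf{a}$ over $\mathbb{N}$ is $\mathbf{B}$-admissible if $\mathbf{a}=d_{\mathbf{B}}(x)$ for some $x\in[0,1)$. $V_b\colon\mathbb{N}\to\mathbb{N}$ is given by $V_b(0)=1$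 and, for $n\ge1$, $V_b(n)=b^i$ where $b^i$ is the largest power of $b$ dividing $n$; the structure $\langle\mathbb{N},+,V_b\rangle$ has domain $\mathbb{N}$ and the graphs of $+$ and $V_b$ as relations. *)

theory Defs
  imports "HOL-Analysis.Analysis" "HOL-Library.Nat_Bijection"
begin

section \<open>Cantor real bases\<close>

definition cantor_real_base :: "(nat \<Rightarrow> real) \<Rightarrow> bool" where
  "cantor_real_base B \<longleftrightarrow>
     (\<forall>n. B n > 1) \<and> filterlim (\<lambda>n. \<Prod>i<n. B i) at_top sequentially"

definition shift :: "(nat \<Rightarrow> 'a) \<Rightarrow> nat \<Rightarrow> 'a" where
  "shift x = (\<lambda>n. x (Suc n))"

definition beta_map :: "real \<Rightarrow> real \<Rightarrow> real" where
  "beta_map \<beta> r = \<beta> * r - of_int \<lfloor>\<beta> * r\<rfloor>"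

primrec remainder :: "(nat \<Rightarrow> real) \<Rightarrow> real \<Rightarrow> nat \<Rightarrow> real" where
  "remainder B r 0 = r"
| "remainder B r (Suc n) = beta_map (B n) (remainder B r n)"

definition greedy :: "(nat \<Rightarrow> real) \<Rightarrow> real \<Rightarrow> nat \<Rightarrow> nat" where
  "greedy B r n = nat \<lfloor>B n * remainder B r n\<rfloor>"

text \<open>The topology on \<^typ>\<open>nat \<Rightarrow> nat\<close> is the product of the discrete topologies.\<close>

definition quasi_greedy :: "(nat \<Rightarrow> real) \<Rightarrow> real \<Rightarrow> nat \<Rightarrow> nat" where
  "quasi_greedy B r = (THE l. (greedy B \<longlongrightarrow> l) (at_left r))"

definition admissible :: "(nat \<Rightarrow> real) \<Rightarrow> (nat \<Rightarrow> nat) \<Rightarrow> bool" where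
  "admissible B a \<longleftrightarrow> (\<exists>x. 0 \<le> x \<and> x < 1 \<and> a = greedy B x)"

text \<open>The limit defining the quasi-greedy expansion exists and is unique.\<close>

lemma tendsto_fun_iff:
  fixes f :: "'a \<Rightarrow> 'b \<Rightarrow> 'c::topological_space"
  shows "(f \<longlongrightarrow> l) F \<longleftrightarrow> (\<forall>i. ((\<lambda>z. f z i) \<longlongrightarrow> l i) F)"
  using limitin_componentwise[of "\<lambda>_. euclidean" UNIV f l F]
  by (simp add: euclidean_product_topology)

lemma floor_at_left:
  assumes "filterlim f (at_left L) F"
  shows "\<forall>\<^sub>F z in F. \<lfloor>f z\<rfloor> = \<lceil>L::real\<rceil> - 1"
proof -
  have "\<forall>\<^sub>F y in at_left L. \<lfloor>y\<rfloor> = \<lceil>L\<rceil> - 1"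
  proof (rule eventually_at_leftI[of "of_int (\<lceil>L\<rceil> - 1)"])
    show "of_int (\<lceil>L\<rceil> - 1) < L" by linarith
    fix y assume "y \<in> {real_of_int (\<lceil>L\<rceil> - 1)<..<L}"
    then show "\<lfloor>y\<rfloor> = \<lceil>L\<rceil> - 1"
      by (auto simp: floor_eq_iff) linarith
  qed
  then show ?thesis using assms by (rule eventually_compose_filterlim)
qed

lemma quasi_greedy_tendsto:
  assumes B: "\<And>n. B n > 0"
  shows "(greedy B \<longlongrightarrow> quasi_greedy B r) (at_left r)"
proof -
  have left: "filterlim f (at_left L) F \<longleftrightarrow> (f \<longlongrightarrow> L) F \<and> (\<forall>\<^sub>F z in F. f z < L)"
    for f and L :: real and F :: "real filter"
    by (auto simp: filterlim_at eventually_conj_iff elim!: eventually_mono)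
  have scale: "filterlim (\<lambda>z. B n * f z - c) (at_left (B n * L - c)) F"
    if "filterlim f (at_left L) F" for f and L c and F :: "real filter" and n
    using that B[of n] unfolding left by (auto intro!: tendsto_intros)
  have ex: "\<exists>L. filterlim (\<lambda>z. remainder B z n) (at_left L) (at_left r)" for n
  proof (induction n)
    case 0
    have "filterlim (\<lambda>z. remainder B z 0) (at_left r) (at_left r)"
      by (simp add: filterlim_ident)
    then show ?case ..
  next
    case (Suc n)
    then obtain L where L: "filterlim (\<lambda>z. remainder B z n) (at_left L) (at_left r)" ..
    let ?c = "of_int (\<lceil>B n * L\<rceil> - 1) :: real"
    have "\<forall>\<^sub>F z in at_left r. \<lfloor>B n * remainder B z n\<rfloor> = \<lceil>B n * L\<rceil> - 1"
      using floor_at_left[OF scale[OF L, of n 0]] by simp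
    then have "\<forall>\<^sub>F z in at_left r. B n * remainder B z n - ?c = remainder B z (Suc n)"
      by (rule eventually_mono) (simp add: beta_map_def)
    with scale[OF L, of n ?c]
    have "filterlim (\<lambda>z. remainder B z (Suc n)) (at_left (B n * L - ?c)) (at_left r)"
      by (rule filterlim_mono_eventually[OF _ order_refl order_refl])
    then show ?case ..
  qed
  have "\<exists>d. ((\<lambda>z. greedy B z n) \<longlongrightarrow> d) (at_left r)" for n
  proof -
    obtain L where L: "filterlim (\<lambda>z. remainder B z n) (at_left L) (at_left r)"
      using ex ..
    have "\<forall>\<^sub>F z in at_left r. \<lfloor>B n * remainder B z n\<rfloor> = \<lceil>B n * L\<rceil> - 1"
      using floor_at_left[OF scale[OF L, of n 0]] by simp
    then have "\<forall>\<^sub>F z in at_left r. greedy B z n = nat (\<lceil>B n * L\<rceil> - 1)"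
      by (rule eventually_mono) (simp add: greedy_def)
    then have "((\<lambda>z. greedy B z n) \<longlongrightarrow> nat (\<lceil>B n * L\<rceil> - 1)) (at_left r)"
      by (rule tendsto_eventually)
    then show ?thesis ..
  qed
  then have "\<forall>n. \<exists>d. ((\<lambda>z. greedy B z n) \<longlongrightarrow> d) (at_left r)" ..
  from choice[OF this] obtain d where "\<forall>n. ((\<lambda>z. greedy B z n) \<longlongrightarrow> d n) (at_left r)" ..
  then have d: "(greedy B \<longlongrightarrow> d) (at_left r)"
    by (subst tendsto_fun_iff)
  have "l = d" if l: "(greedy B \<longlongrightarrow> l) (at_left r)" for l
  proof
    fix n
    show "l n = d n"
      using l d unfolding tendsto_fun_iff[of "greedy B"]
      by (intro tendsto_unique[OF trivial_limit_at_left_real]) (erule spec)+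
  qed
  with d show ?thesis
    unfolding quasi_greedy_def by (rule theI)
qed


section \<open>First-order logic over addition and \<open>V\<^sub>b\<close>\<close>

definition V :: "nat \<Rightarrow> nat \<Rightarrow> nat" where
  "V b n = (if n = 0 then 1 else b ^ multiplicity b n)"

datatype fo_formula =
    Eq nat nat
  | Plus nat nat nat
  | VGraph nat nat
  | Neg fo_formula
  | Conj fo_formula fo_formula
  | Ex nat fo_formula

primrec fo_sat :: "nat \<Rightarrow> (nat \<Rightarrow> nat) \<Rightarrow> fo_formula \<Rightarrow> bool" where
  "fo_sat b e (Eq x y) \<longleftrightarrow> e x = e y"
| "fo_sat b e (Plus x y z) \<longleftrightarrow> e x + e y = e z"
| "fo_sat b e (VGraph x y) \<longleftrightarrow> V b (e x) = e y"
| "fo_sat b e (Neg f) \<longleftrightarrow> \<not> fo_sat b e f"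
| "fo_sat b e (Conj f g) \<longleftrightarrow> fo_sat b e f \<and> fo_sat b e g"
| "fo_sat b e (Ex x f) \<longleftrightarrow> (\<exists>k. fo_sat b (e(x := k)) f)"

primrec free_vars :: "fo_formula \<Rightarrow> nat set" where
  "free_vars (Eq x y) = {x, y}"
| "free_vars (Plus x y z) = {x, y, z}"
| "free_vars (VGraph x y) = {x, y}"
| "free_vars (Neg f) = free_vars f"
| "free_vars (Conj f g) = free_vars f \<union> free_vars g"
| "free_vars (Ex x f) = free_vars f - {x}"


section \<open>Automatic sequences\<close>

text \<open>Canonical base-\<open>b\<close> representation, most significant digit first;
  zero is represented by the empty word.\<close>

fun base_rep :: "nat \<Rightarrow> nat \<Rightarrow> nat list" where
  "base_rep b n = (if b < 2 \<or> n = 0 then [] else base_rep b (n div b) @ [n mod b])"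

declare base_rep.simps [simp del]

text \<open>A deterministic finite automaton with output, with states \<open>0, \<dots>, m - 1\<close> where \<open>m\<close> is the
  length of both tables: row \<open>q\<close> of the transition table lists the successors of \<open>q\<close> under the
  letters \<open>0, \<dots>, b - 1\<close>, and entry \<open>q\<close> of the output table is the output of \<open>q\<close>.\<close>

datatype dfao = DFAO (init: nat) (trans: "nat list list") (outp: "nat list")

definition wf_dfao :: "nat \<Rightarrow> dfao \<Rightarrow> bool" where
  "wf_dfao b M \<longleftrightarrow>
     init M < length (outp M) \<and> length (trans M) = length (outp M) \<and>
     (\<forall>row \<in> set (trans M). length row = b \<and> (\<forall>q \<in> set row. q < length (outp M)))"

definition dfao_run :: "dfao \<Rightarrow> nat list \<Rightarrow> nat" where
  "dfao_run M w = foldl (\<lambda>q c. trans M ! q ! c) (init M) w"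

definition dfao_seq :: "nat \<Rightarrow> dfao \<Rightarrow> nat \<Rightarrow> nat" where
  "dfao_seq b M n = outp M ! dfao_run M (base_rep b n)"

definition dfao_encode :: "dfao \<Rightarrow> nat" where
  "dfao_encode M =
     prod_encode (init M,
       prod_encode (list_encode (map list_encode (trans M)), list_encode (outp M)))"


section \<open>Decidability\<close>

text \<open>The total recursive functions (Kleene): \<open>recursive k f\<close> means that \<open>f\<close>, restricted to lists
  of length \<open>k\<close>, is a total recursive function of \<open>k\<close> arguments. Minimisation is only applied
  where it yields a total function. Values on lists of other lengths are irrelevant.\<close>

inductive recursive :: "nat \<Rightarrow> (nat list \<Rightarrow> nat) \<Rightarrow> bool" where
  zero: "recursive k (\<lambda>_. 0)"
| succ: "recursive 1 (\<lambda>xs. Suc (xs ! 0))"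
| proj: "i < k \<Longrightarrow> recursive k (\<lambda>xs. xs ! i)"
| comp: "recursive (length gs) f \<Longrightarrow> \<forall>g \<in> set gs. recursive k g
    \<Longrightarrow> recursive k (\<lambda>xs. f (map (\<lambda>g. g xs) gs))"
| prim_rec: "recursive k f \<Longrightarrow> recursive (Suc (Suc k)) g
    \<Longrightarrow> recursive (Suc k) (\<lambda>xs. rec_nat (f (tl xs)) (\<lambda>y r. g (y # r # tl xs)) (hd xs))"
| mu: "recursive (Suc k) f \<Longrightarrow> \<forall>xs. length xs = k \<longrightarrow> (\<exists>y. f (y # xs) = 0)
    \<Longrightarrow> recursive k (\<lambda>xs. LEAST y. f (y # xs) = 0)"
| ext: "recursive k f \<Longrightarrow> \<forall>xs. length xs = k \<longrightarrow> g xs = f xs \<Longrightarrow> recursive k g"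

definition decidable :: "nat set \<Rightarrow> bool" where
  "decidable D \<longleftrightarrow> recursive 1 (\<lambda>xs. if xs ! 0 \<in> D then 1 else 0)"

end

theory Submission
  imports Defs
begin

text \<open>By a Parry-type criterion, a sequence \<open>a\<close> is admissible iff for every \<open>n\<close> its \<open>n\<close>-th shift is
  lexicographically smaller than the quasi-greedy expansion of 1 in the \<open>n\<close>-th shift of the base.
  Given the formulas \<open>\<phi> a\<close>, this is a first-order condition over addition, \<open>V b\<close> and the fibres of
  the sequence.

  Predicates of this kind have finite kernels: for a predicate \<open>P\<close> on assignments, only finitely many
  predicates arise by repeatedly passing from \<open>P e\<close> to \<open>P (b e + r)\<close> with digits \<open>r < b\<close>. A bound on
  the size of the kernel is computable from the automaton, and by pumping it bounds a witness of any
  satisfied existential quantifier. So every quantifier can be replaced by a computably bounded one,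
  and no automata have to be constructed by the decision procedure.\<close>

section \<open>Closure properties of the recursive functions\<close>

text \<open>The formulas, the alphabet and the base are fixed, so the recursion over a formula takes
  place outside the decision procedure, whose only input is the code \<open>c\<close> of an
  automaton. Closure properties are therefore proved for families indexed by \<open>c\<close>, with
  a kernel bound that is a recursive function of \<open>c\<close>; for each single automaton,
  decidability would be trivial. Residuals strip the least significant digits, whereas automata read
  the most significant digit first. The two fit because, apart from the number zero, the run on
  \<open>b * n + r\<close> is one step after the run on \<open>n\<close>, so a residual pulls back a
  set of states. Finiteness of \<open>E\<close> bounds the digits, so that comparing two digits is a
  finite disjunction over fibres. In the criterion the delicate point is strictness: summing the
  digits gives values that are only known to be at most 1 in the limit.\<close>

lemma recursive_compose1:
  assumes "recursive 1 (\<lambda>xs. f (xs ! 0))" "recursive k g"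
  shows "recursive k (\<lambda>xs. f (g xs))"
  using recursive.comp[of "[g]" "\<lambda>xs. f (xs ! 0)" k] assms by simp

lemma recursive_Suc:
  assumes "recursive k f"
  shows "recursive k (\<lambda>xs. Suc (f xs))"
  using recursive_compose1[OF recursive.succ assms] .

lemma recursive_const: "recursive k (\<lambda>_. n)"
  by (induction n) (auto intro: recursive.zero recursive_Suc)

text \<open>Recursion and minimisation take their variable from the head of the argument list; here
  it is replaced by a value computed from the remaining arguments.\<close>

lemma recursive_subst_hd:
  assumes "recursive (Suc k) f" "recursive k n"
  shows "recursive k (\<lambda>xs. f (n xs # xs))"
proof -
  let ?gs = "n # map (\<lambda>i xs. xs ! i) [0..<k]"
  have "recursive k (\<lambda>xs. f (map (\<lambda>g. g xs) ?gs))"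
    using assms by (intro recursive.comp) (auto intro: recursive.proj)
  then show ?thesis
    by (rule recursive.ext) (auto simp: comp_def map_nth)
qed

text \<open>Weakening: makes a function available under a newly bound variable at the head.\<close>

lemma recursive_tl:
  assumes "recursive k f"
  shows "recursive (Suc k) (\<lambda>ys. f (tl ys))"
proof -
  let ?gs = "map (\<lambda>i (xs::nat list). xs ! Suc i) [0..<k]"
  have "recursive (Suc k) (\<lambda>xs. f (map (\<lambda>g. g xs) ?gs))"
    using assms by (intro recursive.comp) (auto intro: recursive.proj)
  then show ?thesis
  proof (rule recursive.ext, intro allI impI)
    fix xs :: "nat list" assume "length xs = Suc k"
    then have "map (\<lambda>i. xs ! Suc i) [0..<k] = tl xs"
      by (intro nth_equalityI) (auto simp: nth_tl)
    then show "f (tl xs) = f (map (\<lambda>g. g xs) ?gs)" by (simp add: comp_def)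
  qed
qed

lemma recursive_hd: "recursive (Suc k) hd"
  by (rule recursive.ext[OF recursive.proj[of 0 "Suc k"]]) (auto intro!: hd_conv_nth)

lemma recursive_rec_nat:
  assumes "recursive k f" "recursive (Suc (Suc k)) (\<lambda>ys. g (hd ys) (hd (tl ys)) (tl (tl ys)))"
    and "recursive k n"
  shows "recursive k (\<lambda>xs. rec_nat (f xs) (\<lambda>y r. g y r xs) (n xs))"
  using recursive_subst_hd[OF recursive.prim_rec[OF assms(1,2)] assms(3)] by simp

lemma recursive_add:
  assumes "recursive k f" "recursive k g"
  shows "recursive k (\<lambda>xs. f xs + g xs)"
proof -
  have "rec_nat m (\<lambda>_ r. Suc r) n = m + n" for m n :: nat by (induction n) auto
  then show ?thesis
    using recursive_rec_nat[OF assms(1) _ assms(2), of "\<lambda>_ r _. Suc r"]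
    by (simp add: recursive_Suc recursive_tl[OF recursive_hd])
qed

lemma recursive_mult:
  assumes "recursive k f" "recursive k g"
  shows "recursive k (\<lambda>xs. f xs * g xs)"
proof -
  have "rec_nat 0 (\<lambda>_ r. r + m) n = m * n" for m n :: nat by (induction n) auto
  then show ?thesis
    using recursive_rec_nat[OF recursive.zero _ assms(2), of "\<lambda>_ r xs. r + f xs"]
      recursive_add[OF recursive_tl[OF recursive_hd] recursive_tl[OF recursive_tl[OF assms(1)]]]
    by simp
qed

lemma recursive_power:
  assumes "recursive k f" "recursive k g"
  shows "recursive k (\<lambda>xs. f xs ^ g xs)"
proof -
  have "rec_nat 1 (\<lambda>_ r. r * m) n = m ^ n" for m n :: nat by (induction n) auto
  then show ?thesis
    using recursive_rec_nat[OF recursive_const[of _ 1] _ assms(2), of "\<lambda>_ r xs. r * f xs"]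
      recursive_mult[OF recursive_tl[OF recursive_hd] recursive_tl[OF recursive_tl[OF assms(1)]]]
    by simp
qed

lemma recursive_diff:
  assumes "recursive k f" "recursive k g"
  shows "recursive k (\<lambda>xs. f xs - g xs)"
proof -
  have "rec_nat 0 (\<lambda>y _. y) n = n - 1" for n :: nat by (cases n) auto
  then have pred: "recursive k' (\<lambda>xs. h xs - 1)" if "recursive k' h" for k' h
    using recursive_rec_nat[OF recursive.zero _ that, of "\<lambda>y _ _. y"] by (simp add: recursive_hd)
  have "rec_nat m (\<lambda>_ r. r - 1) n = m - n" for m n :: nat by (induction n) auto
  then show ?thesis
    using recursive_rec_nat[OF assms(1) _ assms(2), of "\<lambda>_ r _. r - 1"]
      pred[OF recursive_tl[OF recursive_hd]] by simp
qed

section \<open>Recursive predicates, bounded quantifiers and minimisation\<close>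

definition recursive_pred :: "nat \<Rightarrow> (nat list \<Rightarrow> bool) \<Rightarrow> bool" where
  "recursive_pred k P \<longleftrightarrow> recursive k (\<lambda>xs. of_bool (P xs))"

lemma recursive_pred_cong:
  assumes "recursive_pred k P" "\<And>xs. length xs = k \<Longrightarrow> Q xs = P xs"
  shows "recursive_pred k Q"
  using assms unfolding recursive_pred_def by (auto elim!: recursive.ext)

lemma recursive_pred_const: "recursive_pred k (\<lambda>_. P)"
  unfolding recursive_pred_def by (rule recursive_const)

lemma recursive_pred_not:
  assumes "recursive_pred k P"
  shows "recursive_pred k (\<lambda>xs. \<not> P xs)"
proof -
  have "of_bool (\<not> Q) = (1::nat) - of_bool Q" for Q by simp
  then show ?thesis
    using recursive_diff[OF recursive_const[of k 1] assms[unfolded recursive_pred_def]]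
    by (simp only: recursive_pred_def)
qed

lemma recursive_pred_conj:
  assumes "recursive_pred k P" "recursive_pred k Q"
  shows "recursive_pred k (\<lambda>xs. P xs \<and> Q xs)"
  using recursive_mult assms by (simp add: recursive_pred_def of_bool_conj)

lemma recursive_pred_disj:
  assumes "recursive_pred k P" "recursive_pred k Q"
  shows "recursive_pred k (\<lambda>xs. P xs \<or> Q xs)"
  using recursive_pred_not[OF recursive_pred_conj[OF assms[THEN recursive_pred_not]]] by simp

lemma recursive_pred_le:
  assumes "recursive k f" "recursive k g"
  shows "recursive_pred k (\<lambda>xs. f xs \<le> g xs)"
proof -
  have "of_bool (m \<le> n) = 1 - (m - n)" for m n :: nat by auto
  then show ?thesis
    using recursive_diff[OF recursive_const[of k 1] recursive_diff[OF assms]]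
    by (simp add: recursive_pred_def)
qed

lemma recursive_pred_less:
  assumes "recursive k f" "recursive k g"
  shows "recursive_pred k (\<lambda>xs. f xs < g xs)"
  using recursive_pred_not[OF recursive_pred_le[OF assms(2,1)]] by (simp add: not_le)

lemma recursive_pred_eq:
  assumes "recursive k f" "recursive k g"
  shows "recursive_pred k (\<lambda>xs. f xs = g xs)"
  using recursive_pred_conj[OF recursive_pred_le[OF assms] recursive_pred_le[OF assms(2,1)]]
  by (simp add: order_eq_iff)

lemma recursive_if:
  assumes "recursive_pred k P" "recursive k f" "recursive k g"
  shows "recursive k (\<lambda>xs. if P xs then f xs else g xs)"
proof -
  have "(if Q then m else n) = of_bool Q * m + of_bool (\<not> Q) * n" for Q and m n :: nat by auto
  then show ?thesis
    using assms(1) recursive_pred_not[OF assms(1)] assms(2,3)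
    by (simp add: recursive_pred_def recursive_add recursive_mult)
qed

lemma recursive_pred_bex:
  assumes "recursive_pred (Suc k) (\<lambda>ys. P (hd ys) (tl ys))" "recursive k n"
  shows "recursive_pred k (\<lambda>xs. \<exists>y<n xs. P y xs)"
proof -
  \<comment> \<open>Counts the witnesses below the bound, so that the quantifier becomes a primitive
    recursion followed by a positivity test.\<close>
  let ?c = "\<lambda>xs. rec_nat (0::nat) (\<lambda>y r. r + of_bool (P y xs))"
  \<comment> \<open>The step function also receives the count so far as its second argument, which
    \<open>P\<close> has to skip.\<close>
  have "recursive (Suc (Suc k)) (\<lambda>ys. of_bool (P (hd ys) (tl (tl ys))))"
  proof -
    let ?gs = "(\<lambda>ys. ys ! 0) # map (\<lambda>i (xs::nat list). xs ! Suc (Suc i)) [0..<k]"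
    have "recursive (Suc (Suc k)) (\<lambda>ys. (\<lambda>ys. of_bool (P (hd ys) (tl ys))) (map (\<lambda>g. g ys) ?gs))"
      using assms(1) unfolding recursive_pred_def
      by (intro recursive.comp) (auto intro: recursive.proj)
    then show ?thesis
    proof (rule recursive.ext, intro allI impI)
      fix xs :: "nat list" assume l: "length xs = Suc (Suc k)"
      then have "map (\<lambda>i. xs ! Suc (Suc i)) [0..<k] = tl (tl xs)"
        by (intro nth_equalityI) (auto simp: nth_tl)
      with l show "of_bool (P (hd xs) (tl (tl xs))) =
         (\<lambda>ys. of_bool (P (hd ys) (tl ys))) (map (\<lambda>g. g xs) ?gs)"
        by (cases xs) (simp_all add: comp_def)
    qed
  qed
  then have "recursive k (\<lambda>xs. ?c xs (n xs))"
    using assms(2)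
    by (intro recursive_rec_nat recursive.zero recursive_add recursive_tl[OF recursive_hd])
  moreover have "(\<exists>y<m. P y xs) \<longleftrightarrow> 0 < ?c xs m" for m xs
    by (induction m) (auto simp: less_Suc_eq)
  ultimately show ?thesis
    by (simp add: recursive_pred_less recursive.zero)
qed

lemma recursive_pred_ball:
  assumes "recursive_pred (Suc k) (\<lambda>ys. P (hd ys) (tl ys))" "recursive k n"
  shows "recursive_pred k (\<lambda>xs. \<forall>y<n xs. P y xs)"
  using recursive_pred_not[OF recursive_pred_bex[OF recursive_pred_not[OF assms(1)] assms(2)]]
  by simp

lemma recursive_Least:
  assumes "recursive_pred (Suc k) (\<lambda>ys. P (hd ys) (tl ys))"
    and "\<And>xs. length xs = k \<Longrightarrow> \<exists>y. P y xs"
  shows "recursive k (\<lambda>xs. LEAST y. P y xs)"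
  using recursive.mu[OF recursive_pred_not[OF assms(1), unfolded recursive_pred_def]] assms(2)
  by simp

lemma recursive_div:
  assumes "recursive k f" "recursive k g"
  shows "recursive k (\<lambda>xs. f xs div g xs)"
proof -
  \<comment> \<open>The disjunct \<open>n = 0\<close> keeps the minimisation total and then yields
    0, the value of division by zero.\<close>
  have "(LEAST q. m < Suc q * n \<or> n = 0) = m div n" for m n :: nat
  proof (cases "n = 0")
    case False
    show ?thesis
    proof (rule Least_equality)
      show "m < Suc (m div n) * n \<or> n = 0"
        using False by (metis dividend_less_div_times mult_Suc not_gr_zero)
      show "m div n \<le> q" if "m < Suc q * n \<or> n = 0" for q
        using that False by (simp add: less_mult_imp_div_less less_Suc_eq_le[symmetric] del: mult_Suc)
    qed
  qed simp
  moreover have "recursive k (\<lambda>xs. LEAST q. f xs < Suc q * g xs \<or> g xs = 0)"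
  proof (rule recursive_Least)
    show "recursive_pred (Suc k) (\<lambda>ys. f (tl ys) < Suc (hd ys) * g (tl ys) \<or> g (tl ys) = 0)"
      by (intro recursive_pred_disj recursive_pred_less recursive_pred_eq recursive_mult
          recursive_Suc recursive_hd recursive_tl assms recursive.zero)
    show "\<exists>q. f xs < Suc q * g xs \<or> g xs = 0" for xs
      by (rule exI[of _ "f xs"]) (cases "g xs"; simp)
  qed
  ultimately show ?thesis by simp
qed

lemma recursive_mod:
  assumes "recursive k f" "recursive k g"
  shows "recursive k (\<lambda>xs. f xs mod g xs)"
  using recursive_diff[OF assms(1) recursive_mult[OF assms(2) recursive_div[OF assms]]]
  by (simp add: minus_mult_div_eq_mod)

section \<open>Codes of pairs and lists\<close>

lemma recursive_prod_encode:
  assumes "recursive k f" "recursive k g"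
  shows "recursive k (\<lambda>xs. prod_encode (f xs, g xs))"
  using assms unfolding prod_encode_def triangle_def split_conv
  by (intro recursive_add recursive_div recursive_mult recursive_Suc recursive_const)

lemma prod_decode_eq_iff: "prod_decode n = (i, j) \<longleftrightarrow> prod_encode (i, j) = n"
  by (metis prod_decode_inverse prod_encode_inverse)

lemma Least_eq_same: "(LEAST i::nat. i = n) = n"
  by (rule Least_equality) auto

lemma recursive_fst_prod_decode:
  assumes "recursive k f"
  shows "recursive k (\<lambda>xs. fst (prod_decode (f xs)))"
proof -
  \<comment> \<open>Components of a pair are at most its code, so the search for the other component
    is bounded.\<close>
  have ex: "(\<exists>j<Suc n. prod_encode (i, j) = n) \<longleftrightarrow> i = fst (prod_decode n)" for i n
    using le_prod_encode_2
    by (auto simp: prod_decode_eq_iff[symmetric] less_Suc_eq_le)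
      (metis prod.collapse prod_decode_eq_iff)
  then have "recursive k (\<lambda>xs. LEAST i. \<exists>j<Suc (f xs). prod_encode (i, j) = f xs)"
    by (intro recursive_Least recursive_pred_bex recursive_pred_eq recursive_prod_encode
        recursive_hd recursive_tl recursive_Suc assms) auto
  then show ?thesis by (simp only: ex Least_eq_same)
qed

lemma recursive_snd_prod_decode:
  assumes "recursive k f"
  shows "recursive k (\<lambda>xs. snd (prod_decode (f xs)))"
proof -
  have ex: "(\<exists>j<Suc n. prod_encode (j, i) = n) \<longleftrightarrow> i = snd (prod_decode n)" for i n
    using le_prod_encode_1
    by (auto simp: prod_decode_eq_iff[symmetric] less_Suc_eq_le)
      (metis prod.collapse prod_decode_eq_iff)
  then have "recursive k (\<lambda>xs. LEAST i. \<exists>j<Suc (f xs). prod_encode (j, i) = f xs)"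
    by (intro recursive_Least recursive_pred_bex recursive_pred_eq recursive_prod_encode
        recursive_hd recursive_tl recursive_Suc assms) auto
  then show ?thesis by (simp only: ex Least_eq_same)
qed

text \<open>A nonempty list is coded by the successor of the pair of its head and the code of its
  tail, so \<open>c - 1\<close> is that pair. As 0 codes the pair \<open>(0, 0)\<close>, the tail of
  the empty list is again empty.\<close>

definition code_tl :: "nat \<Rightarrow> nat" where
  "code_tl c = snd (prod_decode (c - 1))"

definition code_nth :: "nat \<Rightarrow> nat \<Rightarrow> nat" where
  "code_nth c i = fst (prod_decode ((code_tl ^^ i) c - 1))"

definition code_length :: "nat \<Rightarrow> nat" where
  "code_length c = (LEAST i. (code_tl ^^ i) c = 0)"

lemma code_tl_list_encode: "code_tl (list_encode xs) = list_encode (tl xs)"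
proof (cases xs)
  case Nil
  have "prod_decode 0 = (0, 0)" by (simp add: prod_decode_eq_iff prod_encode_def triangle_def)
  with Nil show ?thesis by (simp add: code_tl_def)
qed (simp add: code_tl_def)

lemma code_tl_funpow: "(code_tl ^^ i) (list_encode xs) = list_encode (drop i xs)"
  by (induction i arbitrary: xs)
    (simp_all add: code_tl_list_encode drop_Suc funpow_swap1 del: funpow.simps(2)
      add: funpow_Suc_right)

lemma list_encode_eq_0_iff: "list_encode xs = 0 \<longleftrightarrow> xs = []"
  by (cases xs) auto

lemma code_length_list_encode: "code_length (list_encode xs) = length xs"
  unfolding code_length_def code_tl_funpow list_encode_eq_0_iff
  by (rule Least_equality) auto

lemma code_nth_list_encode:
  assumes "i < length xs"
  shows "code_nth (list_encode xs) i = xs ! i"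
  using assms by (simp add: code_nth_def code_tl_funpow Cons_nth_drop_Suc[symmetric])

lemma code_tl_le: "code_tl c \<le> c"
  using le_prod_encode_2[of "snd (prod_decode (c - 1))" "fst (prod_decode (c - 1))"]
  by (simp add: code_tl_def)

text \<open>Bounds the states read from a number by that number, well-formed or not; the computable
  kernel bound for the fibres rests on this.\<close>

lemma code_nth_le: "code_nth c i \<le> c"
proof -
  have "(code_tl ^^ i) c \<le> c"
    by (induction i) (auto intro: order_trans[OF code_tl_le])
  moreover have "code_nth c i \<le> (code_tl ^^ i) c"
    using le_prod_encode_1[of "fst (prod_decode ((code_tl ^^ i) c - 1))" "snd (prod_decode ((code_tl ^^ i) c - 1))"]
    by (simp add: code_nth_def)
  ultimately show ?thesis by simp
qed

lemma recursive_code_tl_funpow: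
  assumes "recursive k f" "recursive k g"
  shows "recursive k (\<lambda>xs. (code_tl ^^ g xs) (f xs))"
proof -
  have "rec_nat c (\<lambda>_ r. code_tl r) i = (code_tl ^^ i) c" for c i
    by (induction i) auto
  moreover have "recursive k (\<lambda>xs. rec_nat (f xs) (\<lambda>_ r. code_tl r) (g xs))"
    using assms unfolding code_tl_def
    by (intro recursive_rec_nat recursive_snd_prod_decode recursive_diff recursive_const
        recursive_tl recursive_hd)
  ultimately show ?thesis by simp
qed

lemma recursive_code_nth:
  assumes "recursive k f" "recursive k g"
  shows "recursive k (\<lambda>xs. code_nth (f xs) (g xs))"
  using assms unfolding code_nth_def
  by (intro recursive_fst_prod_decode recursive_diff recursive_const recursive_code_tl_funpow)

lemma recursive_code_length:
  assumes "recursive k f"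
  shows "recursive k (\<lambda>xs. code_length (f xs))"
  unfolding code_length_def
proof (rule recursive_Least)
  show "recursive_pred (Suc k) (\<lambda>ys. (code_tl ^^ hd ys) (f (tl ys)) = 0)"
    by (intro recursive_pred_eq recursive_code_tl_funpow recursive_tl assms recursive_hd
        recursive_const)
  \<comment> \<open>Every number is the code of a list, so the iterated tail reaches 0.\<close>
  show "\<exists>y. (code_tl ^^ y) (f xs) = 0" for xs
    using code_tl_funpow[of "length (list_decode (f xs))" "list_decode (f xs)"] by auto
qed

section \<open>Predicates with finite kernel\<close>

definition residual :: "nat \<Rightarrow> (nat \<Rightarrow> nat) \<Rightarrow> ((nat \<Rightarrow> nat) \<Rightarrow> bool) \<Rightarrow> (nat \<Rightarrow> nat) \<Rightarrow> bool" where
  "residual b r P = (\<lambda>e. P (\<lambda>i. b * e i + r i))"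

lemma residual_fun_upd:
  "residual b (r(x := s)) P (e(x := k)) \<longleftrightarrow> P ((\<lambda>i. b * e i + r i)(x := b * k + s))"
proof -
  have "(\<lambda>i. b * (e(x := k)) i + (r(x := s)) i) = (\<lambda>i. b * e i + r i)(x := b * k + s)" by auto
  then show ?thesis by (simp only: residual_def)
qed

text \<open>\<open>K\<close> plays the state set of an automaton that reads one digit of every
  variable per step. Any closed set containing \<open>P\<close> is allowed, so closure proofs may
  choose a convenient superset of the kernel.\<close>

definition kernel_bounded :: "nat \<Rightarrow> nat \<Rightarrow> ((nat \<Rightarrow> nat) \<Rightarrow> bool) \<Rightarrow> bool" where
  "kernel_bounded b N P \<longleftrightarrow> (\<exists>K. finite K \<and> card K \<le> N \<and> P \<in> K \<and>
     (\<forall>Q\<in>K. \<forall>r. (\<forall>i. r i < b) \<longrightarrow> residual b r Q \<in> K))"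

lemma kernel_boundedI:
  assumes "finite K" "card K \<le> N" "P \<in> K"
    and "\<And>Q r. Q \<in> K \<Longrightarrow> (\<And>i. r i < b) \<Longrightarrow> residual b r Q \<in> K"
  shows "kernel_bounded b N P"
  using assms unfolding kernel_bounded_def by blast

lemma kernel_boundedE:
  assumes "kernel_bounded b N P"
  obtains K where "finite K" "card K \<le> N" "P \<in> K"
    "\<And>Q r. Q \<in> K \<Longrightarrow> (\<And>i. r i < b) \<Longrightarrow> residual b r Q \<in> K"
  using assms unfolding kernel_bounded_def by blast

section \<open>Closure of finite kernels under connectives and projection\<close>

lemma kernel_bounded_not:
  assumes "kernel_bounded b N P"
  shows "kernel_bounded b N (\<lambda>e. \<not> P e)"
proof -
  obtain K where K: "finite K" "card K \<le> N" "P \<in> K"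
    "\<And>Q r. Q \<in> K \<Longrightarrow> (\<And>i. r i < b) \<Longrightarrow> residual b r Q \<in> K"
    using assms by (rule kernel_boundedE) blast
  show ?thesis
  proof (rule kernel_boundedI)
    let ?K = "(\<lambda>Q e. \<not> Q e) ` K"
    show "finite ?K" "(\<lambda>e. \<not> P e) \<in> ?K" using K by auto
    show "card ?K \<le> N" using card_image_le[OF K(1)] K(2) by (rule order_trans)
    show "residual b r Q \<in> ?K" if "Q \<in> ?K" "\<And>i. r i < b" for Q r
    proof -
      from that obtain Q' where Q': "Q' \<in> K" "Q = (\<lambda>e. \<not> Q' e)" by blast
      then have "residual b r Q = (\<lambda>e. \<not> residual b r Q' e)" by (simp add: residual_def)
      then show ?thesis using K(4)[OF Q'(1) that(2)] by (rule image_eqI)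
    qed
  qed
qed

text \<open>Product construction: states are pairs, and the bounds multiply.\<close>

lemma kernel_bounded_conj:
  assumes "kernel_bounded b N P" "kernel_bounded b M Q"
  shows "kernel_bounded b (N * M) (\<lambda>e. P e \<and> Q e)"
proof -
  obtain K where K: "finite K" "card K \<le> N" "P \<in> K"
    "\<And>Q r. Q \<in> K \<Longrightarrow> (\<And>i. r i < b) \<Longrightarrow> residual b r Q \<in> K"
    using assms(1) by (rule kernel_boundedE) blast
  obtain L where L: "finite L" "card L \<le> M" "Q \<in> L"
    "\<And>Q r. Q \<in> L \<Longrightarrow> (\<And>i. r i < b) \<Longrightarrow> residual b r Q \<in> L"
    using assms(2) by (rule kernel_boundedE) blast
  show ?thesis
  proof (rule kernel_boundedI)
    let ?K = "(\<lambda>(P, Q) e. P e \<and> Q e) ` (K \<times> L)"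
    show "finite ?K" using K L by auto
    show "(\<lambda>e. P e \<and> Q e) \<in> ?K" using K(3) L(3) by (auto intro!: rev_image_eqI[of "(P, Q)"])
    have "card ?K \<le> card (K \<times> L)" using K(1) L(1) by (intro card_image_le) auto
    also have "\<dots> \<le> N * M" using K(2) L(2) by (simp add: card_cartesian_product mult_le_mono)
    finally show "card ?K \<le> N * M" .
    show "residual b r R \<in> ?K" if "R \<in> ?K" "\<And>i. r i < b" for R r
    proof -
      from that obtain P' Q' where R: "P' \<in> K" "Q' \<in> L" "R = (\<lambda>e. P' e \<and> Q' e)" by auto
      then have "residual b r R = (\<lambda>e. residual b r P' e \<and> residual b r Q' e)"
        by (simp add: residual_def)
      with K(4)[OF R(1) that(2)] L(4)[OF R(2) that(2)] show ?thesis
        by (auto intro!: rev_image_eqI[of "(residual b r P', residual b r Q')"])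
    qed
  qed
qed

text \<open>The subset construction: the residuals of a projection are projections of unions of residuals.
  Since digits are read starting with the least significant one, leading zeros play no role.\<close>

lemma kernel_bounded_ex:
  assumes "kernel_bounded b N P" "b > 0"
  shows "kernel_bounded b (2 ^ N) (\<lambda>e. \<exists>k. P (e(x := k)))"
proof -
  obtain K where K: "finite K" "card K \<le> N" "P \<in> K"
    "\<And>Q r. Q \<in> K \<Longrightarrow> (\<And>i. r i < b) \<Longrightarrow> residual b r Q \<in> K"
    using assms(1) by (rule kernel_boundedE) blast
  show ?thesis
  proof (rule kernel_boundedI)
    let ?ex = "\<lambda>T e. \<exists>k. \<exists>Q\<in>T. Q (e(x := k))"
    let ?K = "?ex ` Pow K"
    show "finite ?K" using K by auto
    show "(\<lambda>e. \<exists>k. P (e(x := k))) \<in> ?K" using K(3) by (auto intro!: rev_image_eqI[of "{P}"])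
    have "card ?K \<le> card (Pow K)" using K(1) by (intro card_image_le) auto
    also have "\<dots> \<le> 2 ^ N" using K(1,2) by (simp add: card_Pow)
    finally show "card ?K \<le> 2 ^ N" .
    show "residual b r R \<in> ?K" if "R \<in> ?K" and r: "\<And>i. r i < b" for R r
    proof -
      from that obtain T where T: "T \<subseteq> K" "R = ?ex T" by auto
      \<comment> \<open>The digit \<open>s\<close> of the projected variable is guessed: a witness
        \<open>k\<close> splits into \<open>k mod b\<close>, which selects the residual, and
        \<open>k div b\<close>, which is a witness for it.\<close>
      let ?T = "{residual b (r(x := s)) Q | s Q. s < b \<and> Q \<in> T}"
      have "residual b r R e \<longleftrightarrow> ?ex ?T e" for e
      proof
        assume "residual b r R e"
        then obtain k Q where kQ: "Q \<in> T" "Q ((\<lambda>i. b * e i + r i)(x := k))"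
          unfolding T(2) residual_def by blast
        have "residual b (r(x := k mod b)) Q (e(x := k div b))"
          unfolding residual_fun_upd mult_div_mod_eq by (rule kQ(2))
        moreover have "residual b (r(x := k mod b)) Q \<in> ?T"
          using kQ(1) mod_less_divisor[OF assms(2), of k] by blast
        ultimately show "?ex ?T e" by blast
      next
        assume "?ex ?T e"
        then obtain k s Q where "Q \<in> T" "residual b (r(x := s)) Q (e(x := k))" by blast
        then show "residual b r R e" unfolding residual_fun_upd unfolding T(2) residual_def by blast
      qed
      then have "residual b r R = ?ex ?T" unfolding fun_eq_iff by (rule allI)
      moreover have "?T \<subseteq> K" using T(1) r by (auto intro!: K(4))
      ultimately show ?thesis by blast
    qed
  qed
qed

section \<open>Bounding witnesses by pumping\<close>

text \<open>With the other variables at 0, having a witness below \<open>b ^ n\<close> is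
  reachability within \<open>n\<close> steps. The sets of states with this property increase with
  \<open>n\<close> inside \<open>K\<close>, and each is determined by its predecessor, so they are
  stationary from \<open>card K\<close> on.\<close>

lemma kernel_pumping_zero:
  assumes b: "b \<ge> 2" and K: "finite K" "\<And>Q r. Q \<in> K \<Longrightarrow> (\<And>i. r i < b) \<Longrightarrow> residual b r Q \<in> K"
    and Q: "Q \<in> K" "Q ((\<lambda>_. 0)(x := k))"
  shows "\<exists>k < b ^ card K. Q ((\<lambda>_. 0)(x := k))"
proof -
  define f where "f n = {Q \<in> K. \<exists>k < b ^ n. Q ((\<lambda>_. 0)(x := k))}" for n
  have upd: "residual b ((\<lambda>_. 0)(x := s)) Q ((\<lambda>_. 0)(x := k)) \<longleftrightarrow> Q ((\<lambda>_. 0)(x := b * k + s))"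
    for Q k s by (simp add: residual_fun_upd)
  have step: "Q \<in> f (Suc n) \<longleftrightarrow> Q \<in> K \<and> (\<exists>s<b. residual b ((\<lambda>_. 0)(x := s)) Q \<in> f n)" for Q n
  proof safe
    assume "Q \<in> f (Suc n)"
    then obtain k where k: "Q \<in> K" "k < b ^ Suc n" "Q ((\<lambda>_. 0)(x := k))" by (auto simp: f_def)
    have "k div b < b ^ n" using k(2) by (simp add: less_mult_imp_div_less mult.commute)
    moreover have "residual b ((\<lambda>_. 0)(x := k mod b)) Q ((\<lambda>_. 0)(x := k div b))"
      unfolding upd using k(3) by simp
    moreover have "residual b ((\<lambda>_. 0)(x := k mod b)) Q \<in> K"
      using b k(1) by (intro K(2)) auto
    ultimately show "\<exists>s<b. residual b ((\<lambda>_. 0)(x := s)) Q \<in> f n"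
      using b by (intro exI[of _ "k mod b"]) (auto simp: f_def)
  next
    fix s assume "Q \<in> K" "s < b" "residual b ((\<lambda>_. 0)(x := s)) Q \<in> f n"
    then obtain k where k: "k < b ^ n" "Q ((\<lambda>_. 0)(x := b * k + s))"
      by (auto simp: f_def upd)
    have "b * k + s < b * (k + 1)" using \<open>s < b\<close> by simp
    also have "\<dots> \<le> b * b ^ n" using k(1) by (intro mult_le_mono) auto
    finally show "Q \<in> f (Suc n)" using \<open>Q \<in> K\<close> k(2) by (auto simp: f_def)
  qed (simp add: f_def)
  have "f n \<subseteq> f (Suc n)" for n
  proof -
    have "b ^ n \<le> b ^ Suc n" using b by (intro power_increasing) auto
    then show ?thesis unfolding f_def by (blast intro: order.strict_trans2)
  qed
  then have "mono f" by (simp add: mono_iff_le_Suc)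
  moreover have sub: "f n \<subseteq> K" for n by (auto simp: f_def)
  moreover have "finite (range f)"
    using K(1) sub by (intro finite_subset[of "range f" "Pow K"]) auto
  moreover have "\<forall>n. f n = f (Suc n) \<longrightarrow> f (Suc n) = f (Suc (Suc n))"
    using step by blast
  ultimately have "f (card K) = (\<Union>n. f n)"
    using K(1) finite_mono_remains_stable_implies_strict_prefix[of f]
    by (intro finite_mono_strict_prefix_implies_finite_fixpoint) (auto simp: less_le)
  \<comment> \<open>Any witness \<open>k\<close> has at most \<open>k\<close> digits, so
    \<open>Q\<close> occurs in some set of the chain.\<close>
  moreover have "k < b ^ k" using b by (intro power_gt_expt) auto
  then have "Q \<in> f k" using Q by (auto simp: f_def)
  ultimately have "Q \<in> f (card K)" by blast
  then show ?thesis by (simp add: f_def)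
qed

text \<open>The \<open>L\<close> lowest digits of a witness are kept while the digits of the other
  variables are consumed. Afterwards these variables are 0, and the rest of the witness can be
  chosen with at most \<open>N\<close> digits.\<close>

lemma kernel_pumping:
  assumes b: "b \<ge> 2" and "kernel_bounded b N P" and "\<And>i. e i < b ^ L" and "P (e(x := k))"
  shows "\<exists>k < b ^ (L + N). P (e(x := k))"
proof -
  obtain K where K: "finite K" "card K \<le> N" "P \<in> K"
    "\<And>Q r. Q \<in> K \<Longrightarrow> (\<And>i. r i < b) \<Longrightarrow> residual b r Q \<in> K"
    using assms(2) by (rule kernel_boundedE) blast
  from \<open>P \<in> K\<close> assms(3,4) show ?thesis
  proof (induction L arbitrary: P e k)
    case 0
    then have "e = (\<lambda>_. 0)" by auto
    with kernel_pumping_zero[OF b K(1,4) \<open>P \<in> K\<close>, of x k] 0(3)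
    obtain k where k: "k < b ^ card K" "P (e(x := k))" by blast
    moreover have "b ^ card K \<le> b ^ (0 + N)" using b K(2) by (intro power_increasing) auto
    ultimately show ?case using order.strict_trans2 by blast
  next
    case (Suc L)
    let ?r = "\<lambda>s. (\<lambda>i. e i mod b)(x := s)"
    let ?e = "\<lambda>i. e i div b"
    have upd: "residual b (?r s) P (?e(x := k)) \<longleftrightarrow> P (e(x := b * k + s))" for k s
      by (simp add: residual_fun_upd)
    have "residual b (?r (k mod b)) P \<in> K" using b Suc.prems by (intro K(4)) auto
    moreover have "?e i < b ^ L" for i
      using Suc.prems(2)[of i] by (simp add: less_mult_imp_div_less mult.commute)
    moreover have "residual b (?r (k mod b)) P (?e(x := k div b))"
      unfolding upd mult_div_mod_eq by (rule Suc.prems(3))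
    ultimately obtain k' where k': "k' < b ^ (L + N)" "residual b (?r (k mod b)) P (?e(x := k'))"
      using Suc.IH[of "residual b (?r (k mod b)) P" ?e "k div b"] by blast
    have "k mod b < b" using b by simp
    then have "b * k' + k mod b < b * (k' + 1)" by simp
    also have "\<dots> \<le> b * b ^ (L + N)" using k'(1) by (intro mult_le_mono) auto
    finally have "b * k' + k mod b < b ^ (Suc L + N)" by simp
    with k'(2) show ?case unfolding upd by blast
  qed
qed

section \<open>Kernels of the atomic formulas\<close>

lemma V_mult_base:
  assumes "b \<ge> 2" "n > 0"
  shows "V b (b * n) = b * V b n"
  using assms by (simp add: V_def multiplicity_times_same)

lemma V_not_dvd:
  assumes "\<not> b dvd n"
  shows "V b n = 1"
  using assms by (simp add: V_def not_dvd_imp_multiplicity_0)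

lemma base_mult_add_eq_iff:
  fixes b :: nat
  assumes "r < b" "s < b"
  shows "b * m + r = b * n + s \<longleftrightarrow> m = n \<and> r = s"
proof -
  have "(b * m + r) div b = m" "(b * m + r) mod b = r" "(b * n + s) div b = n" "(b * n + s) mod b = s"
    using assms by auto
  then show ?thesis by metis
qed

text \<open>Two states: all digits so far agree, or the dead state.\<close>

lemma kernel_bounded_eq: "kernel_bounded b 2 (\<lambda>e. e x = e y)"
proof (rule kernel_boundedI[of "{\<lambda>e. e x = e y, \<lambda>_. False}"])
  show "card {\<lambda>e. e x = e y, \<lambda>_. False} \<le> 2" by (intro card_insert_le_m1) auto
  fix Q :: "(nat \<Rightarrow> nat) \<Rightarrow> bool" and r :: "nat \<Rightarrow> nat"
  assume Q: "Q \<in> {\<lambda>e. e x = e y, \<lambda>_. False}" and r: "\<And>i. r i < b"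
  show "residual b r Q \<in> {\<lambda>e. e x = e y, \<lambda>_. False}"
  proof -
    have "residual b r (\<lambda>e. e x = e y) = (\<lambda>e. e x = e y \<and> r x = r y)"
      using base_mult_add_eq_iff[OF r r] by (simp add: residual_def)
    then show ?thesis using Q by (cases "r x = r y") (auto simp: residual_def[of _ _ "\<lambda>_. False"])
  qed
qed auto

text \<open>Schoolbook addition: the states are the carries 0 and 1 and a dead state.\<close>

lemma kernel_bounded_plus: "kernel_bounded b 3 (\<lambda>e. e x + e y = e z)"
proof -
  let ?P = "\<lambda>c e. e x + e y + c = (e z :: nat)"
  let ?K = "{?P 0, ?P 1, \<lambda>_. False}"
  show ?thesis
  proof (rule kernel_boundedI)
    show "(\<lambda>e. e x + e y = e z) \<in> ?K" by simp
    show "card ?K \<le> 3" by (intro card_insert_le_m1) auto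
    fix Q and r :: "nat \<Rightarrow> nat"
    assume Q: "Q \<in> ?K" and r: "\<And>i. r i < b"
    have P: "residual b r (?P c) \<in> ?K" if "c \<le> 1" for c
    proof -
      define t where "t = (r x + r y + c) div b"
      define s where "s = (r x + r y + c) mod b"
      have "r x + r y + c < 2 * b" using r[of x] r[of y] that by linarith
      then have "t < 2" unfolding t_def by (simp add: less_mult_imp_div_less)
      then have t: "t = 0 \<or> t = 1" by linarith
      have s: "s < b" using r[of x] by (simp add: s_def)
      have ts: "r x + r y + c = b * t + s" by (simp add: t_def s_def)
      have "residual b r (?P c) e \<longleftrightarrow> b * (e x + e y + t) + s = b * e z + r z" for e
      proof -
        have "b * e x + r x + (b * e y + r y) + c = b * (e x + e y + t) + s"
          using ts by (simp add: algebra_simps)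
        then show ?thesis by (simp only: residual_def)
      qed
      then have "residual b r (?P c) = (\<lambda>e. ?P t e \<and> s = r z)"
        by (simp only: base_mult_add_eq_iff[OF s r] fun_eq_iff) blast
      with t show ?thesis by (cases "s = r z") auto
    qed
    have F: "residual b r (\<lambda>_. False) \<in> ?K" by (simp add: residual_def)
    have P01: "residual b r (?P 0) \<in> ?K" "residual b r (?P 1) \<in> ?K" by (rule P, simp)+
    from Q have "Q = ?P 0 \<or> Q = ?P 1 \<or> Q = (\<lambda>_. False)" by (simp only: insert_iff empty_iff simp_thms)
    then show "residual b r Q \<in> ?K" by (elim disjE) (erule ssubst, fact)+
  qed auto
qed

text \<open>From the lowest digit on, \<open>V b n\<close> copies the trailing zeros of
  \<open>n\<close>, has digit 1 where \<open>n\<close> has its first nonzero digit, and only zeros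
  afterwards (\<open>?Z\<close>). The convention \<open>V b 0 = 1\<close> separates
  \<open>?P\<close> from \<open>?P'\<close>: after a digit 0 of \<open>x\<close>, digit 1 of
  \<open>y\<close> commits to \<open>x\<close> being zero (\<open>?Z'\<close>) and digit 0 commits
  to \<open>x\<close> being positive (\<open>?P'\<close>).\<close>

lemma kernel_bounded_V:
  assumes b: "b \<ge> 2"
  shows "kernel_bounded b 5 (\<lambda>e. V b (e x) = e y)"
proof -
  let ?P = "\<lambda>e. V b (e x) = e y"
  let ?P' = "\<lambda>e. e x > 0 \<and> V b (e x) = e y"
  let ?Z = "\<lambda>e. e y = 0"
  let ?Z' = "\<lambda>e. e x = 0 \<and> e y = 0"
  let ?K = "{?P, ?P', ?Z, ?Z', \<lambda>_. False}"
  show ?thesis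
  proof (rule kernel_boundedI)
    show "card ?K \<le> 5" by (intro card_insert_le_m1) auto
    fix Q and r :: "nat \<Rightarrow> nat"
    assume Q: "Q \<in> ?K" and r: "\<And>i. r i < b"
    have one: "1 = b * n + s \<longleftrightarrow> n = 0 \<and> s = 1" if "s < b" for n s
      using base_mult_add_eq_iff[of 1 b s 0 n] that b by auto
    have nz: "V b (b * m + r x) = 1" if "r x \<noteq> 0" for m
      using that r[of x] by (intro V_not_dvd) (auto simp: dvd_add_right_iff dest: dvd_imp_le)
    have z: "V b (b * m + r x) = b * V b m" if "r x = 0" "m > 0" for m
      using that b by (simp add: V_mult_base)
    have bz: "b * n + s = 0 \<longleftrightarrow> n = 0 \<and> s = 0" for n s using b by auto
    have P: "residual b r ?P \<in> ?K" if "r x \<noteq> 0"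
    proof -
      have "residual b r ?P = (\<lambda>e. e y = 0 \<and> r y = 1)"
        using nz[OF that] one[OF r[of y]] by (simp add: residual_def)
      then show ?thesis by (cases "r y = 1") auto
    qed
    have P': "residual b r ?P' \<in> ?K"
    proof (cases "r x = 0")
      case False
      then have "residual b r ?P' = residual b r ?P" by (auto simp: residual_def)
      with P[OF False] show ?thesis by simp
    next
      case True
      have "residual b r ?P' e \<longleftrightarrow> e x > 0 \<and> b * V b (e x) + 0 = b * e y + r y" for e
        using True b z[OF True] by (auto simp: residual_def)
      then have "residual b r ?P' = (\<lambda>e. ?P' e \<and> 0 = r y)"
        using b r[of y] by (subst (asm) base_mult_add_eq_iff) auto
      then show ?thesis by (cases "r y = 0") auto
    qed
    have P0: "residual b r ?P \<in> ?K" if "r x = 0"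
    proof -
      have "residual b r ?P e \<longleftrightarrow> ?P' e \<and> 0 = r y \<or> e x = 0 \<and> e y = 0 \<and> r y = 1" for e
      proof (cases "e x = 0")
        case True
        then show ?thesis using that r[of y] one[of "r y"] by (auto simp: residual_def V_def)
      next
        case False
        then have "residual b r ?P e \<longleftrightarrow> b * V b (e x) + 0 = b * e y + r y"
          using z[OF that] by (auto simp: residual_def)
        then show ?thesis using False b r[of y] by (subst (asm) base_mult_add_eq_iff) auto
      qed
      then have "residual b r ?P = (\<lambda>e. ?P' e \<and> 0 = r y \<or> e x = 0 \<and> e y = 0 \<and> r y = 1)"
        by blast
      then show ?thesis by (cases "r y = 0"; cases "r y = 1") auto
    qed
    have Z: "residual b r ?Z \<in> ?K"
      by (cases "r y = 0") (use b in \<open>auto simp: residual_def bz\<close>)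
    have Z': "residual b r ?Z' \<in> ?K"
      by (cases "r x = 0 \<and> r y = 0") (use b in \<open>auto simp: residual_def bz\<close>)
    have F: "residual b r (\<lambda>_. False) \<in> ?K" by (simp add: residual_def)
    have P: "residual b r ?P \<in> ?K" by (cases "r x = 0") (rule P P0, assumption)+
    from Q have "Q = ?P \<or> Q = ?P' \<or> Q = ?Z \<or> Q = ?Z' \<or> Q = (\<lambda>_. False)"
      by (simp only: insert_iff empty_iff simp_thms)
    then show "residual b r Q \<in> ?K" by (elim disjE) (erule ssubst, fact)+
  qed auto
qed

section \<open>The lexicographic criterion for admissibility\<close>

lemma funpow_shift: "(shift ^^ n) x = (\<lambda>i. x (n + i))"
  by (induction n) (auto simp: shift_def)

text \<open>The limit of \<open>remainder B z n\<close> as \<open>z\<close> tends to 1 from the left.\<close>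

primrec left_remainder :: "(nat \<Rightarrow> real) \<Rightarrow> nat \<Rightarrow> real" where
  "left_remainder B 0 = 1"
| "left_remainder B (Suc n) =
     B n * left_remainder B n - of_int (\<lceil>B n * left_remainder B n\<rceil> - 1)"

text \<open>Ceiling minus one leaves a rest in \<open>(0, 1]\<close>, where the floor leaves one in
  \<open>[0, 1)\<close>. Its positivity yields the strict inequalities in the sufficiency
  proof.\<close>

lemma left_remainder_bounds: "0 < left_remainder B n \<and> left_remainder B n \<le> 1"
  by (cases n) (simp_all, linarith)

text \<open>Near a limit approached strictly from below the floor is constant, namely the ceiling of
  the limit minus 1, even if the limit is an integer. Hence the induction carries
  \<open>at_left\<close> and not only convergence.\<close>

lemma quasi_greedy_eq:
  assumes B: "\<And>n. B n > 0"
  shows "quasi_greedy B 1 n = nat (\<lceil>B n * left_remainder B n\<rceil> - 1)"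
proof -
  have left: "filterlim f (at_left L) F \<longleftrightarrow> (f \<longlongrightarrow> L) F \<and> (\<forall>\<^sub>F z in F. f z < L)"
    for f and L :: real and F :: "real filter"
    by (auto simp: filterlim_at eventually_conj_iff elim!: eventually_mono)
  have scale: "filterlim (\<lambda>z. B n * f z - c) (at_left (B n * L - c)) F"
    if "filterlim f (at_left L) F" for f and L c and F :: "real filter" and n
    using that B[of n] unfolding left by (auto intro!: tendsto_intros)
  have lim: "filterlim (\<lambda>z. remainder B z n) (at_left (left_remainder B n)) (at_left 1)" for n
  proof (induction n)
    case 0
    show ?case by (simp add: filterlim_ident)
  next
    case (Suc n)
    let ?c = "of_int (\<lceil>B n * left_remainder B n\<rceil> - 1) :: real"
    have "\<forall>\<^sub>F z in at_left 1. \<lfloor>B n * remainder B z n\<rfloor> = \<lceil>B n * left_remainder B n\<rceil> - 1"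
      using floor_at_left[OF scale[OF Suc, of n 0]] by simp
    then have "\<forall>\<^sub>F z in at_left 1. B n * remainder B z n - ?c = remainder B z (Suc n)"
      by (rule eventually_mono) (simp add: beta_map_def)
    with scale[OF Suc, of n ?c] show ?case
      unfolding left_remainder.simps
      by (rule filterlim_mono_eventually[OF _ order_refl order_refl])
  qed
  have "\<forall>\<^sub>F z in at_left 1. \<lfloor>B n * remainder B z n\<rfloor> = \<lceil>B n * left_remainder B n\<rceil> - 1"
    using floor_at_left[OF scale[OF lim[of n], of n 0]] by simp
  then have "\<forall>\<^sub>F z in at_left 1. greedy B z n = nat (\<lceil>B n * left_remainder B n\<rceil> - 1)"
    by (rule eventually_mono) (simp add: greedy_def)
  then have "((\<lambda>z. greedy B z n) \<longlongrightarrow> nat (\<lceil>B n * left_remainder B n\<rceil> - 1)) (at_left 1)"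
    by (rule tendsto_eventually)
  moreover have "((\<lambda>z. greedy B z n) \<longlongrightarrow> quasi_greedy B 1 n) (at_left 1)"
    using quasi_greedy_tendsto[of B 1, OF B] by (simp add: tendsto_fun_iff[of "greedy B"])
  ultimately show ?thesis
    using tendsto_unique[OF trivial_limit_at_left_real] by blast
qed

lemma of_nat_quasi_greedy:
  assumes B: "\<And>n. B n > 0"
  shows "real (quasi_greedy B 1 n) = of_int (\<lceil>B n * left_remainder B n\<rceil> - 1)"
proof -
  have "0 < B n * left_remainder B n" using B left_remainder_bounds by simp
  then have "0 < \<lceil>B n * left_remainder B n\<rceil>" by simp
  then show ?thesis by (simp add: quasi_greedy_eq[OF B])
qed

lemma left_remainder_Suc:
  assumes "\<And>n. B n > 0"
  shows "left_remainder B (Suc n) = B n * left_remainder B n - quasi_greedy B 1 n"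
  using of_nat_quasi_greedy[OF assms] by simp

text \<open>Together with the finiteness of \<open>E\<close> this bounds all digits and makes the
  alphabet finite.\<close>

lemma quasi_greedy_less:
  fixes B :: "nat \<Rightarrow> real"
  assumes B: "\<And>n. B n > 0"
  shows "quasi_greedy B 1 n < B n"
proof -
  have "B n * left_remainder B n \<le> B n * 1"
    using B left_remainder_bounds by (intro mult_left_mono) (auto simp: less_imp_le)
  then show ?thesis
    using left_remainder_Suc[of B n, OF B] left_remainder_bounds[of B "Suc n"] by linarith
qed

section \<open>Necessity of the lexicographic condition\<close>

definition lex_less :: "(nat \<Rightarrow> nat) \<Rightarrow> (nat \<Rightarrow> nat) \<Rightarrow> bool" where
  "lex_less a d \<longleftrightarrow> (\<exists>k. a k < d k \<and> (\<forall>j<k. a j = d j))"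

lemma remainder_bounds:
  assumes "0 \<le> x" "x < 1"
  shows "0 \<le> remainder B x n \<and> remainder B x n < 1"
  using assms by (cases n) (auto simp: beta_map_def, linarith+)

lemma remainder_shift: "remainder B x (n + i) = remainder ((shift ^^ n) B) (remainder B x n) i"
  by (induction i) (auto simp: funpow_shift)

lemma remainder_Suc_greedy:
  assumes "B n > 0" "0 \<le> remainder B x n"
  shows "remainder B x (Suc n) = B n * remainder B x n - greedy B x n"
  using assms by (simp add: beta_map_def greedy_def)

text \<open>As long as the digits agree, the distance of the remainders is multiplied by the bases, so it
  cannot stay below 1 for ever.\<close>

lemma greedy_lex_less_quasi_greedy:
  assumes B: "cantor_real_base B" and x: "0 \<le> x" "x < 1"
  shows "lex_less (greedy B x) (quasi_greedy B 1)"
proof -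
  have B0: "B n > 0" for n
    using B by (metis cantor_real_base_def less_trans zero_less_one)
  let ?a = "greedy B x" and ?d = "quasi_greedy B 1"
  have rem: "0 \<le> remainder B x n" "remainder B x n < 1" for n
    using remainder_bounds[OF x] by auto
  have dist: "left_remainder B n - remainder B x n = (\<Prod>i<n. B i) * (1 - x)"
    if "\<forall>j<n. ?a j = ?d j" for n
    using that
  proof (induction n)
    case (Suc n)
    then have "left_remainder B (Suc n) - remainder B x (Suc n) =
        B n * (left_remainder B n - remainder B x n)"
      unfolding left_remainder_Suc[OF B0] remainder_Suc_greedy[OF B0 rem(1)]
      by (simp add: algebra_simps)
    with Suc show ?case by (simp add: mult_ac del: left_remainder.simps remainder.simps)
  qed simp
  have "\<exists>k. ?a k \<noteq> ?d k"
  proof (rule ccontr)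
    assume "\<nexists>k. ?a k \<noteq> ?d k"
    then have "(\<Prod>i<n. B i) * (1 - x) \<le> 1" for n
      using dist[of n] left_remainder_bounds[of B n] rem(1)[of n] by auto
    then have le: "(\<Prod>i<n. B i) \<le> 1 / (1 - x)" for n
      using x by (simp add: field_simps)
    have "\<forall>\<^sub>F n in sequentially. 1 / (1 - x) < (\<Prod>i<n. B i)"
      using B by (simp add: cantor_real_base_def filterlim_at_top_dense)
    then obtain n where "1 / (1 - x) < (\<Prod>i<n. B i)"
      using eventually_happens'[OF sequentially_bot] by blast
    with le[of n] show False by simp
  qed
  then obtain k where k: "?a k \<noteq> ?d k" "\<forall>j<k. ?a j = ?d j"
    using exists_least_iff[of "\<lambda>k. ?a k \<noteq> ?d k"] by auto
  have "0 < (\<Prod>i<k. B i) * (1 - x)"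
    using B0 x by (intro mult_pos_pos prod_pos) auto
  then have "remainder B x k < left_remainder B k" using dist[OF k(2)] by simp
  then have "B k * remainder B x k < B k * left_remainder B k" using B0 by simp
  \<comment> \<open>For \<open>y < z\<close> the floor of \<open>y\<close> is at most the ceiling of
    \<open>z\<close> minus 1.\<close>
  then have "?a k \<le> ?d k"
    unfolding greedy_def quasi_greedy_eq[OF B0] by (intro nat_mono) linarith
  with k show ?thesis unfolding lex_less_def by (intro exI[of _ k]) auto
qed

section \<open>Sufficiency of the lexicographic condition\<close>

text \<open>Since \<open>left_remainder\<close> obeys the same recursion with the same digits, a
  strict inequality at \<open>m\<close> travels down to 0, where \<open>left_remainder\<close> is
  1.\<close>

lemma less_one_if_less_left_remainder:
  fixes B x :: "nat \<Rightarrow> real"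
  assumes B: "\<And>n. B n > 0"
    and x: "\<And>j. j < m \<Longrightarrow> B j * x j = quasi_greedy B 1 j + x (Suc j)"
    and "x m < left_remainder B m"
  shows "x 0 < 1"
proof -
  have "x (m - i) < left_remainder B (m - i)" if "i \<le> m" for i
    using that
  proof (induction i)
    case (Suc i)
    let ?j = "m - Suc i"
    have j: "?j < m" "Suc ?j = m - i" using Suc.prems by auto
    then have "B ?j * x ?j < B ?j * left_remainder B ?j"
      using x[OF j(1)] Suc left_remainder_Suc[of B ?j, OF B] by simp
    then show ?case using B[of ?j] by (simp add: mult_less_cancel_left)
  qed (use assms(3) in simp)
  from this[of m] show ?thesis by simp
qed

text \<open>The digit gap of at least 1 at \<open>k\<close> absorbs
  \<open>x (Suc k) \<le> 1\<close>, and strictness comes from the positive left remainder. So a weak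
  bound further on gives a strict one at the start.\<close>

lemma less_one_if_lex_less:
  fixes B x :: "nat \<Rightarrow> real"
  assumes B: "\<And>n. B n > 0"
    and x: "\<And>j. j \<le> k \<Longrightarrow> B j * x j = real (a j) + x (Suc j)"
    and a: "a k < quasi_greedy B 1 k" "\<And>j. j < k \<Longrightarrow> a j = quasi_greedy B 1 j"
    and le: "x (Suc k) \<le> 1"
  shows "x 0 < 1"
proof (rule less_one_if_less_left_remainder[OF B])
  show "B j * x j = quasi_greedy B 1 j + x (Suc j)" if "j < k" for j
    using x[of j] a(2)[OF that] that by simp
  have "B k * x k \<le> quasi_greedy B 1 k" using x[of k] le a(1) by simp
  also have "\<dots> < B k * left_remainder B k"
    using left_remainder_Suc[of B k, OF B] left_remainder_bounds[of B "Suc k"] by simp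
  finally show "x k < left_remainder B k" using B[of k] by (simp add: mult_less_cancel_left)
qed

text \<open>\<open>v n\<close> is the value of the digits from \<open>n\<close> on, cut off at
  \<open>N\<close>, which allows an induction from the end. If the first smaller digit lies before
  \<open>N\<close>, the value after it is below 1 by induction; otherwise the digits before
  \<open>N\<close> are all quasi-greedy, and \<open>v N = 0\<close> lies below the positive left
  remainder.\<close>

lemma truncated_value_less_one:
  fixes a :: "nat \<Rightarrow> nat"
  assumes B: "\<And>n. B n > 0"
    and lex: "\<And>n. lex_less ((shift ^^ n) a) (quasi_greedy ((shift ^^ n) B) 1)"
    and v0: "\<And>n. N \<le> n \<Longrightarrow> v n = 0"
    and v: "\<And>n. n < N \<Longrightarrow> B n * v n = real (a n) + v (Suc n)"
  shows "v n < 1"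
proof (induction "N - n" arbitrary: n rule: less_induct)
  case less
  show ?case
  proof (cases "n < N")
    case True
    let ?B = "(shift ^^ n) B" and ?x = "\<lambda>j. v (n + j)" and ?a = "(shift ^^ n) a"
    have B': "?B i > 0" for i using B by (simp add: funpow_shift)
    obtain k where k: "?a k < quasi_greedy ?B 1 k" "\<And>j. j < k \<Longrightarrow> ?a j = quasi_greedy ?B 1 j"
      using lex[of n] unfolding lex_less_def by blast
    have step: "?B j * ?x j = real (?a j) + ?x (Suc j)" if "n + j < N" for j
      using v[OF that] by (simp add: funpow_shift)
    have "?x 0 < 1"
    proof (cases "n + k < N")
      case True
      show ?thesis
      proof (rule less_one_if_lex_less[of ?B k ?x ?a, OF B'])
        show "?x (Suc k) \<le> 1" using less[of "n + Suc k"] \<open>n < N\<close> by fastforce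
      qed (use k step True in auto)
    next
      case False
      show ?thesis
      proof (rule less_one_if_less_left_remainder[of ?B "N - n" ?x, OF B'])
        show "?B j * ?x j = quasi_greedy ?B 1 j + ?x (Suc j)" if "j < N - n" for j
          using step[of j] k(2)[of j] that False by simp
        show "?x (N - n) < left_remainder ?B (N - n)"
          using v0[of N] \<open>n < N\<close> left_remainder_bounds by simp
      qed
    qed
    then show ?thesis by simp
  qed (simp add: v0)
qed

text \<open>The candidates \<open>x n\<close> for the remainders are limits of the increasing,
  bounded truncated values. Once they lie in \<open>[0, 1)\<close>, their recursion forces every
  digit to be a floor.\<close>

lemma admissible_if_lex_less:
  assumes B: "\<And>n. B n > 0"
    and lex: "\<And>n. lex_less ((shift ^^ n) a) (quasi_greedy ((shift ^^ n) B) 1)"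
  shows "admissible B a"
proof -
  define v where "v N n = (\<Sum>i=n..<N. a i / (\<Prod>j=n..i. B j))" for N n
  have v0: "v N n = 0" if "N \<le> n" for N n using that by (simp add: v_def)
  have v: "B n * v N n = real (a n) + v N (Suc n)" if "n < N" for N n
  proof -
    have "a i / (\<Prod>j=n..i. B j) = a i / (\<Prod>j=Suc n..i. B j) / B n" if "i \<in> {Suc n..<N}" for i
      using that by (subst prod.atLeast_Suc_atMost) auto
    then have "(\<Sum>i=Suc n..<N. a i / (\<Prod>j=n..i. B j)) = v N (Suc n) / B n"
      unfolding v_def sum_divide_distrib by (intro sum.cong) auto
    then have "v N n = a n / B n + v N (Suc n) / B n"
      using that by (simp add: v_def sum.atLeast_Suc_lessThan)
    then show ?thesis using B[of n] by (simp add: field_simps)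
  qed
  have nonneg: "0 \<le> a i / (\<Prod>j=n..i. B j)" for i n
    using B by (intro divide_nonneg_nonneg prod_nonneg) (auto simp: less_imp_le)
  have inc: "incseq (\<lambda>N. v N n)" for n
    unfolding v_def by (intro incseq_SucI sum_mono2) (auto simp: nonneg)
  have lt1: "v N n < 1" for N n
    by (rule truncated_value_less_one[OF B lex v0 v])
  have "\<exists>l. (\<lambda>N. v N n) \<longlonglongrightarrow> l" for n
    by (rule incseq_convergent[OF inc, of n 1]) (auto intro: less_imp_le[OF lt1])
  then have "\<forall>n. \<exists>l. (\<lambda>N. v N n) \<longlonglongrightarrow> l" ..
  from choice[OF this] obtain x where x: "\<And>n. (\<lambda>N. v N n) \<longlonglongrightarrow> x n" by blast
  have x_step: "B n * x n = real (a n) + x (Suc n)" for n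
  proof (rule LIMSEQ_unique)
    show "(\<lambda>N. B n * v N n) \<longlonglongrightarrow> B n * x n" by (intro tendsto_intros x)
    have "(\<lambda>N. real (a n) + v N (Suc n)) \<longlonglongrightarrow> real (a n) + x (Suc n)"
      by (intro tendsto_intros x)
    moreover have "\<forall>\<^sub>F N in sequentially. real (a n) + v N (Suc n) = B n * v N n"
      using eventually_gt_at_top[of n] by eventually_elim (simp add: v)
    ultimately show "(\<lambda>N. B n * v N n) \<longlonglongrightarrow> real (a n) + x (Suc n)"
      by (rule Lim_transform_eventually)
  qed
  have x0: "0 \<le> x n" for n
    using x[of n] by (rule LIMSEQ_le_const) (auto simp: v_def intro!: sum_nonneg nonneg)
  have x1: "x n \<le> 1" for n
    using x[of n] by (rule LIMSEQ_le_const2) (auto intro: less_imp_le[OF lt1])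
  \<comment> \<open>The limit only keeps \<open>x n \<le> 1\<close>; the lexicographic condition at
    \<open>n\<close> restores strictness.\<close>
  have x_less: "x n < 1" for n
  proof -
    let ?B = "(shift ^^ n) B" and ?a = "(shift ^^ n) a"
    have B': "?B i > 0" for i using B by (simp add: funpow_shift)
    obtain k where k: "?a k < quasi_greedy ?B 1 k" "\<And>j. j < k \<Longrightarrow> ?a j = quasi_greedy ?B 1 j"
      using lex[of n] unfolding lex_less_def by blast
    have "(\<lambda>j. x (n + j)) 0 < 1"
      by (rule less_one_if_lex_less[of ?B k "\<lambda>j. x (n + j)" ?a, OF B' _ k])
        (auto simp: funpow_shift x_step x1)
    then show ?thesis by simp
  qed
  have floor: "\<lfloor>B n * x n\<rfloor> = int (a n)" for n
    using x0[of "Suc n"] x_less[of "Suc n"] by (simp add: x_step floor_eq_iff)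
  have rem: "remainder B (x 0) n = x n" for n
    by (induction n) (simp_all add: beta_map_def floor, simp add: x_step)
  have "a = greedy B (x 0)"
    by (simp add: fun_eq_iff greedy_def rem floor)
  then show ?thesis unfolding admissible_def using x0 x_less by blast
qed

section \<open>Passing to shifted bases and the criterion\<close>

lemma cantor_real_base_shift:
  assumes "cantor_real_base B"
  shows "cantor_real_base ((shift ^^ n) B)"
proof -
  have B: "B i > 1" for i using assms by (simp add: cantor_real_base_def)
  have P: "(\<Prod>i<n. B i) > 0" using B by (intro prod_pos) (metis less_trans zero_less_one)
  have "filterlim (\<lambda>m. \<Prod>i<m + n. B i) at_top sequentially"
    using assms filterlim_compose[OF _ filterlim_add_const_nat_at_top]
    by (auto simp: cantor_real_base_def)
  moreover have "(\<Prod>i<m + n. B i) / (\<Prod>i<n. B i) = (\<Prod>i<m. B (n + i))" for m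
  proof -
    have "(\<Prod>i<m + n. B i) = (\<Prod>i<n. B i) * (\<Prod>i<m. B (n + i))"
      by (induction m) (simp_all add: add.commute)
    then show ?thesis using P by (metis less_irrefl nonzero_mult_div_cancel_left)
  qed
  ultimately have "filterlim (\<lambda>m. \<Prod>i<m. B (n + i)) at_top sequentially"
    using filterlim_at_top_mult_tendsto_pos[OF tendsto_const[of "1 / (\<Prod>i<n. B i)"]] P
    by fastforce
  then show ?thesis using B by (simp add: cantor_real_base_def funpow_shift)
qed

lemma admissible_iff_lex_less:
  assumes "cantor_real_base B"
  shows "admissible B a \<longleftrightarrow> (\<forall>n. lex_less ((shift ^^ n) a) (quasi_greedy ((shift ^^ n) B) 1))"
proof
  assume "admissible B a"
  then obtain x where x: "0 \<le> x" "x < 1" "a = greedy B x" by (auto simp: admissible_def)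
  show "\<forall>n. lex_less ((shift ^^ n) a) (quasi_greedy ((shift ^^ n) B) 1)"
  proof
    fix n
    have "(shift ^^ n) a = greedy ((shift ^^ n) B) (remainder B x n)"
      by (simp add: x(3) greedy_def funpow_shift remainder_shift fun_eq_iff)
    then show "lex_less ((shift ^^ n) a) (quasi_greedy ((shift ^^ n) B) 1)"
      using greedy_lex_less_quasi_greedy[OF cantor_real_base_shift[OF assms]]
        remainder_bounds[OF x(1,2)] by simp
  qed
next
  assume "\<forall>n. lex_less ((shift ^^ n) a) (quasi_greedy ((shift ^^ n) B) 1)"
  moreover have "B n > 0" for n
    using assms by (metis cantor_real_base_def less_trans zero_less_one)
  ultimately show "admissible B a" by (intro admissible_if_lex_less) auto
qed

section \<open>Uniform decidability\<close>

text \<open>Recursive functions take finitely many arguments, so an assignment is given by its first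
  \<open>p\<close> values. The default 0 keeps every other variable within the bound that
  \<open>kernel_pumping\<close> asks for.\<close>

definition env :: "nat \<Rightarrow> nat list \<Rightarrow> nat \<Rightarrow> nat" where
  "env p xs = (\<lambda>i. if i < p then xs ! i else 0)"

text \<open>The parameter \<open>c\<close> of the family will be the code of an automaton; \<open>p\<close> bounds the variables in
  use. The bound on the kernels is what makes the search in \<open>uniformly_automatic_ex\<close> finite.\<close>

definition uniformly_automatic :: "nat \<Rightarrow> nat \<Rightarrow> (nat \<Rightarrow> (nat \<Rightarrow> nat) \<Rightarrow> bool) \<Rightarrow> bool" where
  "uniformly_automatic b p F \<longleftrightarrow>
     (\<exists>h. recursive 1 (\<lambda>xs. h (xs ! 0)) \<and> (\<forall>c. kernel_bounded b (h c) (F c))) \<and>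
     recursive_pred (Suc p) (\<lambda>xs. F (hd xs) (env p (tl xs)))"

lemma uniformly_automaticI:
  assumes "recursive 1 (\<lambda>xs. h (xs ! 0))" "\<And>c. kernel_bounded b (h c) (F c)"
    and "recursive_pred (Suc p) (\<lambda>xs. F (hd xs) (env p (tl xs)))"
  shows "uniformly_automatic b p F"
  using assms unfolding uniformly_automatic_def by blast

lemma uniformly_automaticE:
  assumes "uniformly_automatic b p F"
  obtains h where "recursive 1 (\<lambda>xs. h (xs ! 0))" "\<And>c. kernel_bounded b (h c) (F c)"
    "recursive_pred (Suc p) (\<lambda>xs. F (hd xs) (env p (tl xs)))"
  using assms unfolding uniformly_automatic_def by blast

lemma uniformly_automatic_cong:
  assumes "uniformly_automatic b p F" "\<And>c e. G c e = F c e"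
  shows "uniformly_automatic b p G"
proof -
  have "G = F" using assms(2) by (simp add: fun_eq_iff)
  with assms(1) show ?thesis by simp
qed

section \<open>Closure of uniform families under logical operations\<close>

lemma uniformly_automatic_not:
  assumes "uniformly_automatic b p F"
  shows "uniformly_automatic b p (\<lambda>c e. \<not> F c e)"
  using assms by (elim uniformly_automaticE)
    (rule uniformly_automaticI, auto intro: kernel_bounded_not recursive_pred_not)

lemma uniformly_automatic_conj:
  assumes "uniformly_automatic b p F" "uniformly_automatic b p G"
  shows "uniformly_automatic b p (\<lambda>c e. F c e \<and> G c e)"
proof -
  obtain h where h: "recursive 1 (\<lambda>xs. h (xs ! 0))" "\<And>c. kernel_bounded b (h c) (F c)"
    "recursive_pred (Suc p) (\<lambda>xs. F (hd xs) (env p (tl xs)))"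
    using assms(1) by (rule uniformly_automaticE) blast
  obtain h' where h': "recursive 1 (\<lambda>xs. h' (xs ! 0))" "\<And>c. kernel_bounded b (h' c) (G c)"
    "recursive_pred (Suc p) (\<lambda>xs. G (hd xs) (env p (tl xs)))"
    using assms(2) by (rule uniformly_automaticE) blast
  show ?thesis
    by (rule uniformly_automaticI[of "\<lambda>c. h c * h' c"])
      (intro recursive_mult kernel_bounded_conj recursive_pred_conj h h')+
qed

lemma uniformly_automatic_False: "uniformly_automatic b p (\<lambda>_ _. False)"
proof (rule uniformly_automaticI)
  show "recursive 1 (\<lambda>_. 1)" by (rule recursive_const)
  show "kernel_bounded b 1 (\<lambda>_. False)"
    by (rule kernel_boundedI[of "{\<lambda>_. False}"]) (auto simp: residual_def)
qed (rule recursive_pred_const)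

lemma uniformly_automatic_bex:
  assumes "finite I" "\<And>i. i \<in> I \<Longrightarrow> uniformly_automatic b p (F i)"
  shows "uniformly_automatic b p (\<lambda>c e. \<exists>i\<in>I. F i c e)"
  using assms
proof (induction I rule: finite_induct)
  case (insert j I)
  have "uniformly_automatic b p (\<lambda>c e. \<not> (\<not> F j c e \<and> \<not> (\<exists>i\<in>I. F i c e)))"
    using insert by (intro uniformly_automatic_not uniformly_automatic_conj) auto
  then show ?case by (rule uniformly_automatic_cong) blast
qed (simp add: uniformly_automatic_False)

lemma recursive_sum_nth:
  assumes "m \<le> p"
  shows "recursive p (\<lambda>xs. \<Sum>i<m. xs ! i)"
  using assms
proof (induction m)
  case (Suc m)
  then have "recursive p (\<lambda>xs. (\<Sum>i<m. xs ! i) + xs ! m)"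
    by (intro recursive_add recursive.proj) auto
  then show ?case by simp
qed (simp add: recursive.zero)

lemma env_list_update:
  assumes "length xs = p" "x < p"
  shows "env p (xs[x := k]) = (env p xs)(x := k)"
  using assms by (auto simp: env_def nth_list_update)

lemma uniformly_automatic_ex:
  assumes b: "b \<ge> 2" and "uniformly_automatic b p F" and x: "x < p"
  shows "uniformly_automatic b p (\<lambda>c e. \<exists>k. F c (e(x := k)))"
proof -
  obtain h where h: "recursive 1 (\<lambda>xs. h (xs ! 0))" "\<And>c. kernel_bounded b (h c) (F c)"
    "recursive_pred (Suc p) (\<lambda>xs. F (hd xs) (env p (tl xs)))"
    using assms(2) by (rule uniformly_automaticE) blast
  \<comment> \<open>\<open>kernel_pumping\<close> needs some \<open>L\<close> with all values below
    \<open>b ^ L\<close>; the sum of the values is a crude but recursive choice.\<close>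
  let ?bd = "\<lambda>xs. b ^ ((\<Sum>i<p. tl xs ! i) + h (hd xs))"
  have bound: "(\<exists>k. F (hd xs) ((env p (tl xs))(x := k))) \<longleftrightarrow>
      (\<exists>k<?bd xs. F (hd xs) ((env p (tl xs))(x := k)))" for xs
  proof -
    let ?s = "\<Sum>i<p. tl xs ! i"
    have "env p (tl xs) i < b ^ ?s" for i
    proof (cases "i < p")
      case True
      then have "tl xs ! i \<le> ?s" by (intro member_le_sum) auto
      also have "?s < b ^ ?s" using b by (intro power_gt_expt) auto
      finally show ?thesis using True by (simp add: env_def)
    qed (use b in \<open>simp add: env_def\<close>)
    then show ?thesis using kernel_pumping[OF b h(2)] by blast
  qed
  have eval: "recursive_pred (Suc (Suc p)) (\<lambda>ys. F (hd (tl ys)) ((env p (tl (tl ys)))(x := hd ys)))"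
  proof -
    \<comment> \<open>The witness precedes the code in the list: \<open>k # c # zs\<close> becomes
      \<open>c # zs[x := k]\<close>.\<close>
    let ?gs = "(\<lambda>ys. ys ! 1) #
      map (\<lambda>i. if i = x then (\<lambda>ys. ys ! 0) else (\<lambda>ys. ys ! Suc (Suc i))) [0..<p]"
    have "recursive (Suc (Suc p)) (\<lambda>ys. (\<lambda>xs. of_bool (F (hd xs) (env p (tl xs)))) (map (\<lambda>g. g ys) ?gs))"
      using h(3) unfolding recursive_pred_def
      by (intro recursive.comp) (auto intro: recursive.proj)
    then show ?thesis
      unfolding recursive_pred_def
    proof (rule recursive.ext, intro allI impI)
      fix ys :: "nat list" assume l: "length ys = Suc (Suc p)"
      then obtain k c zs where ys: "ys = k # c # zs" "length zs = p"
        by (auto simp: length_Suc_conv)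
      then have "map (\<lambda>i. (if i = x then (\<lambda>ys. ys ! 0) else (\<lambda>ys. ys ! Suc (Suc i))) ys) [0..<p] = zs[x := k]"
        by (intro nth_equalityI) (auto simp: nth_list_update)
      then show "of_bool (F (hd (tl ys)) ((env p (tl (tl ys)))(x := hd ys))) =
          (\<lambda>xs. of_bool (F (hd xs) (env p (tl xs)))) (map (\<lambda>g. g ys) ?gs)"
        using ys x by (simp add: comp_def env_list_update)
    qed
  qed
  show ?thesis
  proof (rule uniformly_automaticI)
    show "recursive 1 (\<lambda>xs. 2 ^ h (xs ! 0))"
      by (intro recursive_power recursive_const h(1))
    show "kernel_bounded b (2 ^ h c) (\<lambda>e. \<exists>k. F c (e(x := k)))" for c
      using b by (intro kernel_bounded_ex h(2)) auto
    show "recursive_pred (Suc p) (\<lambda>xs. \<exists>k. F (hd xs) ((env p (tl xs))(x := k)))"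
      unfolding bound
      by (intro recursive_pred_bex eval recursive_power recursive_add recursive_const
          recursive_tl[OF recursive_sum_nth] recursive_compose1[OF h(1)] recursive_hd order_refl)
  qed
qed

section \<open>Atomic and arbitrary first-order formulas\<close>

lemma recursive_env:
  assumes "i < p"
  shows "recursive (Suc p) (\<lambda>xs. env p (tl xs) i)"
  using recursive_tl[OF recursive.proj[OF assms]] assms by (simp add: env_def)

lemma uniformly_automatic_eq:
  assumes "x < p" "y < p"
  shows "uniformly_automatic b p (\<lambda>_ e. e x = e y)"
  by (rule uniformly_automaticI[of "\<lambda>_. 2"])
    (intro recursive_const kernel_bounded_eq recursive_pred_eq recursive_env assms)+

lemma uniformly_automatic_plus:
  assumes "x < p" "y < p" "z < p"
  shows "uniformly_automatic b p (\<lambda>_ e. e x + e y = e z)"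
  by (rule uniformly_automaticI[of "\<lambda>_. 3"])
    (intro recursive_const kernel_bounded_plus recursive_pred_eq recursive_add recursive_env assms)+

text \<open>Replaces the multiplicity by a search over exponents \<open>k < m\<close>, which is
  recursive and suffices because \<open>k < b ^ k \<le> m\<close>.\<close>

lemma V_eq_iff:
  assumes b: "b \<ge> 2"
  shows "V b m = n \<longleftrightarrow> m = 0 \<and> n = 1 \<or>
    0 < m \<and> (\<exists>k<m. n = b ^ k \<and> m mod b ^ k = 0 \<and> m mod b ^ Suc k \<noteq> 0)"
proof (cases "m = 0")
  case False
  let ?k = "multiplicity b m"
  have u: "\<not> is_unit b" using b by auto
  have k: "b ^ ?k dvd m" "\<not> b ^ Suc ?k dvd m"
    using multiplicity_dvd False u power_dvd_iff_le_multiplicity[of m b "Suc ?k"] b by auto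
  have "?k < b ^ ?k" using b by (intro power_gt_expt) auto
  also have "\<dots> \<le> m" using k(1) False by (intro dvd_imp_le) auto
  finally have "?k < m" .
  moreover have "j = ?k" if "b ^ j dvd m" "\<not> b ^ Suc j dvd m" for j
    using multiplicity_eqI[OF that] by simp
  ultimately have "n = b ^ ?k \<longleftrightarrow> (\<exists>j<m. n = b ^ j \<and> b ^ j dvd m \<and> \<not> b ^ Suc j dvd m)"
    using k by blast
  then show ?thesis
    using False by (simp only: V_def mod_eq_0_iff_dvd) auto
qed (auto simp: V_def)

lemma uniformly_automatic_V:
  assumes b: "b \<ge> 2" and "x < p" "y < p"
  shows "uniformly_automatic b p (\<lambda>_ e. V b (e x) = e y)"
proof (rule uniformly_automaticI[of "\<lambda>_. 5"])
  show "recursive_pred (Suc p) (\<lambda>xs. V b (env p (tl xs) x) = env p (tl xs) y)"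
    unfolding V_eq_iff[OF b]
    by (intro recursive_pred_disj recursive_pred_conj recursive_pred_bex recursive_pred_not
        recursive_pred_eq recursive_pred_less recursive_mod recursive_power recursive_Suc
        recursive_const recursive_hd recursive_env recursive_tl[OF recursive_env] assms)
qed (intro recursive_const kernel_bounded_V b)+

text \<open>Bound variables count as well, because quantifiers are evaluated by overwriting a
  position below \<open>p\<close>.\<close>

primrec all_vars :: "fo_formula \<Rightarrow> nat set" where
  "all_vars (Eq x y) = {x, y}"
| "all_vars (Plus x y z) = {x, y, z}"
| "all_vars (VGraph x y) = {x, y}"
| "all_vars (Neg f) = all_vars f"
| "all_vars (Conj f g) = all_vars f \<union> all_vars g"
| "all_vars (Ex x f) = insert x (all_vars f)"

lemma finite_all_vars: "finite (all_vars f)"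
  by (induction f) auto

lemma uniformly_automatic_fo_sat:
  assumes "b \<ge> 2" "all_vars f \<subseteq> {..<p}"
  shows "uniformly_automatic b p (\<lambda>_ e. fo_sat b e f)"
  using assms(2)
proof (induction f)
  case (Ex x f)
  then show ?case using uniformly_automatic_ex[OF assms(1), of p "\<lambda>_ e. fo_sat b e f" x] by simp
qed (simp_all add: uniformly_automatic_eq uniformly_automatic_plus uniformly_automatic_V assms(1)
    uniformly_automatic_not uniformly_automatic_conj)

section \<open>Automata given by their codes\<close>

text \<open>Reading an automaton directly off its code makes sense for every number \<open>c\<close>: missing table
  entries are read as 0, and all states are at most \<open>c\<close>.\<close>

definition code_init :: "nat \<Rightarrow> nat" where
  "code_init c = fst (prod_decode c)"

definition code_trans :: "nat \<Rightarrow> nat" where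
  "code_trans c = fst (prod_decode (snd (prod_decode c)))"

definition code_outp :: "nat \<Rightarrow> nat" where
  "code_outp c = snd (prod_decode (snd (prod_decode c)))"

definition code_step :: "nat \<Rightarrow> nat \<Rightarrow> nat \<Rightarrow> nat" where
  "code_step c q r = code_nth (code_nth (code_trans c) q) r"

definition code_run :: "nat \<Rightarrow> nat \<Rightarrow> nat \<Rightarrow> nat" where
  "code_run b c n = foldl (code_step c) (code_init c) (base_rep b n)"

definition code_seq :: "nat \<Rightarrow> nat \<Rightarrow> nat \<Rightarrow> nat" where
  "code_seq b c n = code_nth (code_outp c) (code_run b c n)"

definition code_wf :: "nat \<Rightarrow> nat \<Rightarrow> bool" where
  "code_wf b c \<longleftrightarrow>
     code_init c < code_length (code_outp c) \<and>
     code_length (code_trans c) = code_length (code_outp c) \<and>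
     (\<forall>q<code_length (code_trans c). code_length (code_nth (code_trans c) q) = b \<and>
        (\<forall>r<b. code_step c q r < code_length (code_outp c)))"

lemma code_dfao_encode:
  "code_init (dfao_encode M) = init M"
  "code_trans (dfao_encode M) = list_encode (map list_encode (trans M))"
  "code_outp (dfao_encode M) = list_encode (outp M)"
  by (simp_all add: code_init_def code_trans_def code_outp_def dfao_encode_def)

lemma code_step_dfao_encode:
  assumes "q < length (trans M)" "r < length (trans M ! q)"
  shows "code_step (dfao_encode M) q r = trans M ! q ! r"
  using assms by (simp add: code_step_def code_dfao_encode code_nth_list_encode)

lemma code_wf_dfao_encode: "code_wf b (dfao_encode M) \<longleftrightarrow> wf_dfao b M"
  unfolding code_wf_def wf_dfao_def all_set_conv_all_nth
  by (auto simp: code_dfao_encode code_length_list_encode code_nth_list_encode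
      code_step_dfao_encode)

text \<open>Lets the decision procedure work on plain numbers: being the code of a suitable
  automaton becomes a condition read off \<open>c\<close> itself.\<close>

lemma surj_dfao_encode: "\<exists>M. c = dfao_encode M"
proof -
  have "c = dfao_encode (DFAO (code_init c) (map list_decode (list_decode (code_trans c)))
      (list_decode (code_outp c)))"
    by (simp add: dfao_encode_def code_init_def code_trans_def code_outp_def comp_def)
  then show ?thesis ..
qed

lemma base_rep_less: "b \<ge> 2 \<Longrightarrow> r \<in> set (base_rep b n) \<Longrightarrow> r < b"
proof (induction b n rule: base_rep.induct)
  case (1 b n)
  then show ?case
    by (subst (asm) (2) base_rep.simps) (auto split: if_splits)
qed

lemma code_seq_dfao_encode:
  assumes "wf_dfao b M" "b \<ge> 2"
  shows "code_seq b (dfao_encode M) = dfao_seq b M"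
proof
  fix n
  let ?step = "\<lambda>q r. trans M ! q ! r"
  have step: "code_step (dfao_encode M) q r = ?step q r" "?step q r < length (outp M)"
    if "q < length (outp M)" "r < b" for q r
  proof -
    have "trans M ! q \<in> set (trans M)" using assms(1) that by (auto simp: wf_dfao_def)
    then have row: "length (trans M ! q) = b" "\<forall>q' \<in> set (trans M ! q). q' < length (outp M)"
      using assms(1) by (auto simp: wf_dfao_def)
    then show "code_step (dfao_encode M) q r = ?step q r"
      using that assms(1) by (intro code_step_dfao_encode) (auto simp: wf_dfao_def)
    show "?step q r < length (outp M)" using row that by auto
  qed
  \<comment> \<open>Well-formed tables never lead out of range, so no default entry is read.\<close>
  have "foldl (code_step (dfao_encode M)) q w = foldl ?step q w \<and> foldl ?step q w < length (outp M)"
    if "q < length (outp M)" "\<forall>r \<in> set w. r < b" for q w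
    using that by (induction w arbitrary: q) (auto simp: step)
  from this[of "init M" "base_rep b n"] show "code_seq b (dfao_encode M) n = dfao_seq b M n"
    using assms base_rep_less
    by (auto simp: wf_dfao_def code_seq_def code_run_def dfao_seq_def dfao_run_def
        code_dfao_encode code_nth_list_encode)
qed

section \<open>Runs of coded automata\<close>

lemma code_run_0: "code_run b c 0 = code_init c"
  by (simp add: code_run_def base_rep.simps)

lemma code_run_pos:
  assumes "b \<ge> 2" "n > 0"
  shows "code_run b c n = code_step c (code_run b c (n div b)) (n mod b)"
  using assms by (simp add: code_run_def base_rep.simps[of b n])

lemma code_init_le: "code_init c \<le> c"
  using le_prod_encode_1[of "fst (prod_decode c)" "snd (prod_decode c)"]
  by (simp add: code_init_def)

lemma code_step_le: "code_step c q r \<le> c"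
proof -
  have "code_step c q r \<le> code_trans c"
    unfolding code_step_def by (rule order_trans[OF code_nth_le code_nth_le])
  also have "\<dots> \<le> snd (prod_decode c)"
    using le_prod_encode_1[of "code_trans c" "code_outp c"]
    by (simp add: code_trans_def code_outp_def)
  also have "\<dots> \<le> c"
    using le_prod_encode_2[of "snd (prod_decode c)" "fst (prod_decode c)"] by simp
  finally show ?thesis .
qed

lemma code_run_le:
  assumes "b \<ge> 2"
  shows "code_run b c n \<le> c"
  by (cases "n = 0") (simp_all add: assms code_run_0 code_run_pos code_init_le code_step_le)

lemma recursive_code_step:
  assumes "recursive k f" "recursive k g" "recursive k h"
  shows "recursive k (\<lambda>xs. code_step (f xs) (g xs) (h xs))"
  unfolding code_step_def code_trans_def
  by (intro recursive_code_nth recursive_fst_prod_decode recursive_snd_prod_decode assms)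

lemma recursive_code_init:
  assumes "recursive k f"
  shows "recursive k (\<lambda>xs. code_init (f xs))"
  unfolding code_init_def by (intro recursive_fst_prod_decode assms)

lemma recursive_code_seq:
  assumes b: "b \<ge> 2" and f: "recursive k f" and g: "recursive k g"
  shows "recursive k (\<lambda>xs. code_seq b (f xs) (g xs))"
proof -
  \<comment> \<open>After \<open>i\<close> steps the run has read \<open>n div b ^ (n - i)\<close>,
    a prefix of the digits of \<open>n\<close>; \<open>n\<close> steps suffice since
    \<open>n < b ^ n\<close>. The test for 0 skips leading zeros, which \<open>base_rep\<close> does
    not produce.\<close>
  let ?run = "\<lambda>c n. rec_nat (code_init c) (\<lambda>i q.
    if n div b ^ (n - Suc i) = 0 then code_init c
    else code_step c q (n div b ^ (n - Suc i) mod b))"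
  have run: "?run c n i = code_run b c (n div b ^ (n - i))" if "i \<le> n" for c n i
    using that
  proof (induction i)
    case 0
    have "n < b ^ n" using b by (intro power_gt_expt) auto
    then show ?case by (simp add: code_run_0)
  next
    case (Suc i)
    have "n - i = Suc (n - Suc i)" using Suc.prems by simp
    then have "n div b ^ (n - Suc i) div b = n div b ^ (n - i)"
      by (simp add: div_mult2_eq[symmetric] mult.commute)
    then show ?case
      using Suc b code_run_pos[of b "n div b ^ (n - Suc i)" c] by (auto simp: code_run_0)
  qed
  have "recursive k (\<lambda>xs. ?run (f xs) (g xs) (g xs))"
    by (intro recursive_rec_nat recursive_if recursive_pred_eq recursive_code_init
        recursive_code_step recursive_mod recursive_div recursive_power recursive_diff
        recursive_Suc recursive_const recursive_hd recursive_tl[OF recursive_hd]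
        f g recursive_tl[OF recursive_tl[OF f]] recursive_tl[OF recursive_tl[OF g]])
  then have "recursive k (\<lambda>xs. code_run b (f xs) (g xs))" by (simp add: run)
  then show ?thesis
    unfolding code_seq_def code_outp_def
    by (intro recursive_code_nth recursive_snd_prod_decode f)
qed

text \<open>The residuals of the fibres of \<open>code_seq b c\<close> are given by the sets of states from which an
  accepting output is reached after appending fixed digits; zero is represented by the empty word
  and has to be treated separately.\<close>

lemma kernel_bounded_code_seq:
  assumes b: "b \<ge> 2"
  shows "kernel_bounded b (2 * 2 ^ Suc c) (\<lambda>e. code_seq b c (e x) = v)"
proof -
  let ?S = "\<lambda>(t, Q) e. if e x = 0 then t else code_run b c (e x) \<in> Q"
  \<comment> \<open>A truth value for zero and a subset of the \<open>c + 1\<close> possible states: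
    hence the constant \<open>2 * 2 ^ Suc c\<close>.\<close>
  let ?K = "?S ` (UNIV \<times> Pow {..c})"
  show ?thesis
  proof (rule kernel_boundedI)
    show "finite ?K" by auto
    have "card ?K \<le> card ((UNIV :: bool set) \<times> Pow {..c})" by (intro card_image_le) auto
    also have "\<dots> = 2 * 2 ^ Suc c" by (simp add: card_cartesian_product card_Pow)
    finally show "card ?K \<le> 2 * 2 ^ Suc c" .
    let ?Q = "{q. q \<le> c \<and> code_nth (code_outp c) q = v}"
    have "(\<lambda>e. code_seq b c (e x) = v) = ?S (code_nth (code_outp c) (code_init c) = v, ?Q)"
      by (auto simp: fun_eq_iff code_seq_def code_run_0 code_run_le[OF b])
    then show "(\<lambda>e. code_seq b c (e x) = v) \<in> ?K" by (rule image_eqI) auto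
  next
    fix R and r :: "nat \<Rightarrow> nat"
    assume "R \<in> ?K" and r: "\<And>i. r i < b"
    then obtain t Q where R: "R = ?S (t, Q)" by auto
    \<comment> \<open>Appending the digit \<open>r x\<close> to zero gives zero again or takes one
      step from the initial state.\<close>
    let ?t = "if r x = 0 then t else code_step c (code_init c) (r x) \<in> Q"
    let ?Q = "{q. q \<le> c \<and> code_step c q (r x) \<in> Q}"
    have "code_run b c (b * n + r x) = code_step c (code_run b c n) (r x)" if "0 < b * n + r x" for n
      using that b r[of x] by (subst code_run_pos) auto
    then have "residual b r R = ?S (?t, ?Q)"
      using b by (auto simp: fun_eq_iff residual_def R code_run_0 code_run_le)
    then show "residual b r R \<in> ?K" by (rule image_eqI) auto
  qed
qed

lemma uniformly_automatic_code_seq: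
  assumes "b \<ge> 2" "x < p"
  shows "uniformly_automatic b p (\<lambda>c e. code_seq b c (e x) = v)"
  by (rule uniformly_automaticI[of "\<lambda>c. 2 * 2 ^ Suc c"])
    (intro recursive_mult recursive_power recursive_Suc recursive_const recursive.proj
      kernel_bounded_code_seq recursive_pred_eq recursive_code_seq recursive_hd recursive_env
      assms zero_less_one)+

lemma recursive_pred_code_wf: "recursive_pred 1 (\<lambda>xs. code_wf b (hd xs))"
  unfolding code_wf_def code_trans_def code_outp_def One_nat_def
  by (intro recursive_pred_conj recursive_pred_ball recursive_pred_less recursive_pred_eq
      recursive_code_length recursive_code_nth recursive_code_init recursive_code_step
      recursive_fst_prod_decode recursive_snd_prod_decode recursive_const recursive_hd
      recursive_tl[OF recursive_hd] recursive_tl[OF recursive_tl[OF recursive_hd]])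

text \<open>Meant for a family that does not depend on the assignment, where the values 0 are an
  arbitrary choice.\<close>

lemma uniformly_automatic_decidable:
  assumes "uniformly_automatic b p F"
  shows "recursive_pred 1 (\<lambda>xs. F (hd xs) (\<lambda>_. 0))"
proof -
  let ?gs = "(\<lambda>xs. xs ! 0) # replicate p (\<lambda>_. 0 :: nat)"
  have "recursive (Suc p) (\<lambda>xs. of_bool (F (hd xs) (env p (tl xs))))"
    using assms by (simp add: uniformly_automatic_def recursive_pred_def)
  then have "recursive 1 (\<lambda>ys. (\<lambda>xs. of_bool (F (hd xs) (env p (tl xs)))) (map (\<lambda>g. g ys) ?gs))"
    by (intro recursive.comp) (auto intro: recursive.proj recursive.zero)
  then show ?thesis
    unfolding recursive_pred_def
  proof (rule recursive.ext, intro allI impI)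
    fix ys :: "nat list" assume "length ys = 1"
    then obtain c where "ys = [c]" by (auto simp: length_Suc_conv)
    moreover have "env p (replicate p 0) = (\<lambda>_. 0)" by (auto simp: env_def)
    ultimately show "of_bool (F (hd ys) (\<lambda>_. 0)) =
        (\<lambda>xs. of_bool (F (hd xs) (env p (tl xs)))) (map (\<lambda>g. g ys) ?gs)" by simp
  qed
qed

section \<open>Decidability of admissibility\<close>

theorem theorem6p3:
  fixes E :: "real set" and B :: "nat \<Rightarrow> real" and b :: nat
    and A :: "nat set" and \<phi> :: "nat \<Rightarrow> fo_formula"
  assumes "finite E" and "E \<subseteq> {1<..}"
    and "\<forall>n. B n \<in> E" and "cantor_real_base B"
    and "b \<ge> 2"
    and "A = {quasi_greedy ((shift ^^ n) B) 1 j | n j. True}"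
    and "\<forall>a \<in> A. free_vars (\<phi> a) \<subseteq> {0, 1} \<and>
           (\<forall>e j n. fo_sat b (e(0 := j, 1 := n)) (\<phi> a) \<longleftrightarrow>
                    quasi_greedy ((shift ^^ n) B) 1 j = a)"
  shows "decidable {dfao_encode M | M. wf_dfao b M \<and> admissible B (dfao_seq b M)}"
proof -
  note b = \<open>b \<ge> 2\<close>
  define d where "d n j = quasi_greedy ((shift ^^ n) B) 1 j" for n j
  have A: "A = {d n j | n j. True}" using assms(6) by (simp add: d_def)
  have B0: "B n > 0" for n
    using \<open>cantor_real_base B\<close> by (metis cantor_real_base_def less_trans zero_less_one)
  have "d n j \<le> nat \<lceil>Max E\<rceil>" for n j
  proof -
    have "real (d n j) < B (n + j)"
      using quasi_greedy_less[of "(shift ^^ n) B" j] B0 by (simp add: d_def funpow_shift)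
    also have "\<dots> \<le> Max E" using assms(1,3) by simp
    finally show ?thesis by linarith
  qed
  then have "A \<subseteq> {..nat \<lceil>Max E\<rceil>}" by (auto simp: A)
  then have finA: "finite A" by (rule finite_subset) simp
  then have "finite ({..3} \<union> (\<Union>a\<in>A. all_vars (\<phi> a)))" by (simp add: finite_all_vars)
  \<comment> \<open>Variable 0 holds the position \<open>j\<close>, 1 the shift \<open>n\<close>, 2
    an auxiliary number for sums and order, 3 the position of the first difference.\<close>
  then obtain p where "{..3} \<union> (\<Union>a\<in>A. all_vars (\<phi> a)) \<subseteq> {..<p}"
    using finite_nat_bounded by blast
  then have p: "0 < p" "1 < p" "2 < p" "3 < p" "\<And>a. a \<in> A \<Longrightarrow> all_vars (\<phi> a) \<subseteq> {..<p}"
    by (auto simp: subset_iff)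
  let ?UA = "uniformly_automatic b p"
  let ?s = "code_seq b"
  note ex = uniformly_automatic_ex[OF b]

  have digit: "?UA (\<lambda>c e. d (e 1) (e 0) = a)" if "a \<in> A" for a
  proof (rule uniformly_automatic_cong)
    show "?UA (\<lambda>_ e. fo_sat b e (\<phi> a))" by (rule uniformly_automatic_fo_sat[OF b p(5)[OF that]])
    have "fo_sat b (e(0 := e 0, 1 := e 1)) (\<phi> a) \<longleftrightarrow> d (e 1) (e 0) = a" for e
      using assms(7) that by (simp only: d_def)
    then show "(d (e 1) (e 0) = a) = fo_sat b e (\<phi> a)" for e by simp
  qed
  have seq: "?UA (\<lambda>c e. ?s c (e 1 + e 0) = v)" for v
  proof (rule uniformly_automatic_cong)
    show "?UA (\<lambda>c e. \<exists>k. (e(2 := k)) 1 + (e(2 := k)) 0 = (e(2 := k)) 2 \<and> ?s c ((e(2 := k)) 2) = v)"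
      by (rule ex[of p "\<lambda>c e. e 1 + e 0 = e 2 \<and> ?s c (e 2) = v" 2])
        (intro uniformly_automatic_conj uniformly_automatic_plus uniformly_automatic_code_seq p b)+
  qed simp
  \<comment> \<open>Only the fibres of the two sequences are available, so digits are compared value
    by value over the finite alphabet.\<close>
  have eq: "?UA (\<lambda>c e. ?s c (e 1 + e 0) = d (e 1) (e 0))"
  proof (rule uniformly_automatic_cong)
    show "?UA (\<lambda>c e. \<exists>a\<in>A. ?s c (e 1 + e 0) = a \<and> d (e 1) (e 0) = a)"
      by (intro uniformly_automatic_bex finA uniformly_automatic_conj digit seq)
  qed (auto simp: A)
  have less: "?UA (\<lambda>c e. ?s c (e 1 + e 0) < d (e 1) (e 0))"
  proof (rule uniformly_automatic_cong)
    show "?UA (\<lambda>c e. \<exists>a\<in>A. \<exists>v\<in>{..<a}. ?s c (e 1 + e 0) = v \<and> d (e 1) (e 0) = a)"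
      by (intro uniformly_automatic_bex finA uniformly_automatic_conj digit seq finite_lessThan)
  qed (auto simp: A)
  have pos: "?UA (\<lambda>_ e. e 0 < e 3)"
  proof (rule uniformly_automatic_cong)
    show "?UA (\<lambda>c e. (\<exists>k. (e(2 := k)) 0 + (e(2 := k)) 2 = (e(2 := k)) 3) \<and> \<not> e 0 = e 3)"
      by (intro uniformly_automatic_conj uniformly_automatic_not uniformly_automatic_eq p
          ex[of p "\<lambda>c e. e 0 + e 2 = e 3" 2] uniformly_automatic_plus)
    show "(e 0 < e 3) = ((\<exists>k. (e(2 := k)) 0 + (e(2 := k)) 2 = (e(2 := k)) 3) \<and> \<not> e 0 = e 3)"
      for e :: "nat \<Rightarrow> nat" by (simp, metis le_iff_add nat_less_le)
  qed
  have upto: "?UA (\<lambda>c e. \<forall>j<e 3. ?s c (e 1 + j) = d (e 1) j)"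
  proof (rule uniformly_automatic_cong)
    show "?UA (\<lambda>c e. \<not> (\<exists>j. (e(0 := j)) 0 < (e(0 := j)) 3 \<and>
        \<not> ?s c ((e(0 := j)) 1 + (e(0 := j)) 0) = d ((e(0 := j)) 1) ((e(0 := j)) 0)))"
      by (intro uniformly_automatic_not p eq pos uniformly_automatic_conj
          ex[of p "\<lambda>c e. e 0 < e 3 \<and> \<not> ?s c (e 1 + e 0) = d (e 1) (e 0)" 0])
  qed auto
  \<comment> \<open>The formulas expect the position in variable 0; binding 0 to the value of
    variable 3 renames it.\<close>
  have at: "?UA (\<lambda>c e. ?s c (e 1 + e 3) < d (e 1) (e 3))"
  proof (rule uniformly_automatic_cong)
    show "?UA (\<lambda>c e. \<exists>j. (e(0 := j)) 0 = (e(0 := j)) 3 \<and>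
        ?s c ((e(0 := j)) 1 + (e(0 := j)) 0) < d ((e(0 := j)) 1) ((e(0 := j)) 0))"
      by (rule ex[of p "\<lambda>c e. e 0 = e 3 \<and> ?s c (e 1 + e 0) < d (e 1) (e 0)" 0])
        (intro p less uniformly_automatic_conj uniformly_automatic_eq)+
  qed auto
  have lex: "?UA (\<lambda>c e. lex_less ((shift ^^ e 1) (?s c)) (d (e 1)))"
  proof (rule uniformly_automatic_cong)
    show "?UA (\<lambda>c e. \<exists>k. ?s c ((e(3 := k)) 1 + (e(3 := k)) 3) < d ((e(3 := k)) 1) ((e(3 := k)) 3) \<and>
        (\<forall>j<(e(3 := k)) 3. ?s c ((e(3 := k)) 1 + j) = d ((e(3 := k)) 1) j))"
      by (rule ex[of p "\<lambda>c e. ?s c (e 1 + e 3) < d (e 1) (e 3) \<and>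
            (\<forall>j<e 3. ?s c (e 1 + j) = d (e 1) j)" 3])
        (intro p upto at uniformly_automatic_conj)+
  qed (simp add: lex_less_def funpow_shift)
  have "?UA (\<lambda>c e. admissible B (?s c))"
  proof (rule uniformly_automatic_cong)
    show "?UA (\<lambda>c e. \<not> (\<exists>n. \<not> lex_less ((shift ^^ (e(1 := n)) 1) (?s c)) (d ((e(1 := n)) 1))))"
      by (intro uniformly_automatic_not p lex
          ex[of p "\<lambda>c e. \<not> lex_less ((shift ^^ e 1) (?s c)) (d (e 1))" 1])
  qed (simp add: admissible_iff_lex_less[OF \<open>cantor_real_base B\<close>] d_def[abs_def])
  then have "recursive_pred 1 (\<lambda>xs. code_wf b (hd xs) \<and> admissible B (?s (hd xs)))"
    by (intro recursive_pred_conj recursive_pred_code_wf uniformly_automatic_decidable)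
  moreover have "c \<in> {dfao_encode M | M. wf_dfao b M \<and> admissible B (dfao_seq b M)} \<longleftrightarrow>
      code_wf b c \<and> admissible B (?s c)" (is "c \<in> ?D \<longleftrightarrow> _") for c
  proof
    assume "c \<in> ?D"
    then show "code_wf b c \<and> admissible B (?s c)"
      by (auto simp: code_wf_dfao_encode code_seq_dfao_encode b)
  next
    assume c: "code_wf b c \<and> admissible B (?s c)"
    obtain M where "c = dfao_encode M" using surj_dfao_encode by blast
    with c show "c \<in> ?D" by (auto simp: code_wf_dfao_encode code_seq_dfao_encode b)
  qed
  ultimately have "recursive_pred 1 (\<lambda>xs. hd xs \<in> ?D)" by simp
  then have "recursive_pred 1 (\<lambda>xs. xs ! 0 \<in> ?D)"
    by (rule recursive_pred_cong) (auto simp: length_Suc_conv)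
  then show ?thesis by (simp add: decidable_def recursive_pred_def of_bool_def)
qed

end
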